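(* Let $G$ be a finite simple graph with $\operatorname{mad}(G) < 7$. Then $\tau(G) \leq 2\nu(G)$.
   Context: $\nu(G)$ is the maximum number of pairwise edge-disjoint triangles in $G$. $\tau(G)$ is the minimum size of an edge set $Y \subseteq E(G)$ such that $G - Y$ is triangle-free. The maximum average degree is $\operatorname{mad}(G) = \max\{2|E(H)|/|V(H)| : H \subseteq G,\ V(H)\neq\emptyset\}$. *)

theory Defs
  imports Complex_Main
begin

definition simple_graph :: "'a set \<Rightarrow> 'a set set \<Rightarrow> bool" where
  "simple_graph V E \<longleftrightarrow> finite V \<and>
     (\<forall>e\<in>E. \<exists>u v. u \<in> V \<and> v \<in> V \<and> u \<noteq> v \<and> e = {u, v})"

definition triangles :: "'a set set \<Rightarrow> 'a set set set" where
  "triangles E = {T. \<exists>a b c. a \<noteq> b \<and> b \<noteq> c \<and> a \<noteq> c \<and>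
       T = {{a, b}, {b, c}, {a, c}} \<and> T \<subseteq> E}"

definition triangle_free :: "'a set set \<Rightarrow> bool" where
  "triangle_free E \<longleftrightarrow> triangles E = {}"

definition tri_packing :: "'a set set \<Rightarrow> nat" where
  "tri_packing E = Max {card S | S. S \<subseteq> triangles E \<and> pairwise disjnt S}"

definition tri_cover :: "'a set set \<Rightarrow> nat" where
  "tri_cover E = Min {card Y | Y. Y \<subseteq> E \<and> triangle_free (E - Y)}"

definition mad :: "'a set \<Rightarrow> 'a set set \<Rightarrow> real" where
  "mad V E = Max {2 * real (card E') / real (card V') | V' E'.
      V' \<subseteq> V \<and> V' \<noteq> {} \<and> E' \<subseteq> E \<and> (\<forall>e\<in>E'. e \<subseteq> V')}"

end

theory Submission
  imports Defs
begin

text \<open>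
  Call a nonempty set \<open>S\<close> of edge-disjoint triangles together with at most \<open>2|S|\<close> edges \<open>X\<close> a reducer
  if \<open>X\<close> meets every triangle that shares an edge with \<open>S\<close>. Deleting \<open>X\<close> and the edges of \<open>S\<close> lowers
  the packing number by at least \<open>|S|\<close> and the covering number by at most \<open>2|S|\<close>, so a minimal
  counterexample has no reducer, and each of its edges lies in a triangle. Small reducers around one,
  two or three vertices then force the local structure: all degrees are at least 5; the link of a
  low vertex (degree 5 or 6) is complete up to a matching; low vertices are pairwise nonadjacent and,
  by Hall's theorem in the link, fill less than half of any neighbourhood; and a low vertex has few
  neighbours of degree 7. Discharging from vertices of degree at least 8 to low vertices now shows
  that the average degree is at least 7.
\<close>

section \<open>Reducers\<close>

text \<open>The constants answer one obstacle: a vertex of degree 7 has nothing to give. In units of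
  degree, a vertex of degree 6 lacks 1 and one of degree 5 lacks 2. A vertex of degree 6 has at most
  two neighbours of degree 7, so at least four others pay 1/4 each. A vertex of degree 5 with at
  most one neighbour of degree 7 gets 1/2 from each of four others; with two such neighbours only
  three others remain, but these turn out to have degree at least 10 and can pay 2/3 each. The scale
  12 clears the denominators. On the paying side, a vertex of degree d >= 10 pays at most (2/3)(d -
  1)/2, which is at most d - 7 exactly from d = 10 on. At degree 9, four low neighbours cost at most
  2. At degree 8, three low neighbours cost more than 1 only if two of them have degree 5; this one
  case escapes the bound by Hall's theorem and is excluded by a separate search.\<close>

lemma triangleE:
  assumes "T \<in> triangles E" "{p, q} \<in> T"
  obtains r where "p \<noteq> q" "r \<noteq> p" "r \<noteq> q" "T = {{p, q}, {p, r}, {q, r}}"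
    "{p, q} \<in> E" "{p, r} \<in> E" "{q, r} \<in> E"
proof -
  obtain a b c where T: "a \<noteq> b" "b \<noteq> c" "a \<noteq> c" "T = {{a, b}, {b, c}, {a, c}}" "T \<subseteq> E"
    using assms(1) unfolding triangles_def by auto
  have "{p, q} = {a, b} \<or> {p, q} = {b, c} \<or> {p, q} = {a, c}"
    using assms(2) T by auto
  then consider "p = a" "q = b" | "p = b" "q = a" | "p = b" "q = c" | "p = c" "q = b"
    | "p = a" "q = c" | "p = c" "q = a"
    by (auto simp: doubleton_eq_iff)
  moreover have comm: "{b, a} = {a, b}" "{c, a} = {a, c}" "{c, b} = {b, c}" by auto
  ultimately show thesis
  proof cases
    case 1 with T show ?thesis by (intro that[of c]) (auto simp: comm)
  next
    case 2 with T show ?thesis by (intro that[of c]) (auto simp: comm)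
  next
    case 3 with T show ?thesis by (intro that[of a]) (auto simp: comm)
  next
    case 4 with T show ?thesis by (intro that[of a]) (auto simp: comm)
  next
    case 5 with T show ?thesis by (intro that[of b]) (auto simp: comm)
  next
    case 6 with T show ?thesis by (intro that[of b]) (auto simp: comm)
  qed
qed

lemma triangles_mono: "E' \<subseteq> E \<Longrightarrow> triangles E' \<subseteq> triangles E"
  unfolding triangles_def by (intro Collect_mono impI) (elim exE conjE, intro exI conjI, auto)

lemma triangles_subsetD: "T \<in> triangles E \<Longrightarrow> T \<subseteq> E"
  by (auto simp: triangles_def)

lemma triangles_diffI: "T \<in> triangles E \<Longrightarrow> T \<inter> Y = {} \<Longrightarrow> T \<in> triangles (E - Y)"
  unfolding triangles_def mem_Collect_eq by (elim exE conjE, intro exI conjI, assumption+) blast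

lemma triangles_nonempty: "T \<in> triangles E \<Longrightarrow> T \<noteq> {}"
  unfolding triangles_def by auto

lemma finite_triangles: "finite E \<Longrightarrow> finite (triangles E)"
  by (rule finite_subset[of _ "Pow E"]) (auto dest: triangles_subsetD)

section \<open>Packing and cover numbers as attained extrema\<close>

lemma finite_packing_sizes:
  assumes "finite E"
  shows "finite {card S | S. S \<subseteq> triangles E \<and> pairwise disjnt S}"
proof -
  have "{card S | S. S \<subseteq> triangles E \<and> pairwise disjnt S} \<subseteq> card ` Pow (triangles E)" by blast
  then show ?thesis
    using finite_subset finite_triangles[OF assms] by blast
qed

lemma tri_packing_ge:
  assumes "finite E" "S \<subseteq> triangles E" "pairwise disjnt S"
  shows "card S \<le> tri_packing E"
  unfolding tri_packing_def using assms by (intro Max_ge finite_packing_sizes) auto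

lemma tri_packing_witness:
  assumes "finite E"
  obtains S where "S \<subseteq> triangles E" "pairwise disjnt S" "card S = tri_packing E"
proof -
  have "{card S | S. S \<subseteq> triangles E \<and> pairwise disjnt S} \<noteq> {}"
    by (auto intro!: exI[of _ "{}"])
  from Max_in[OF finite_packing_sizes[OF assms] this] show thesis
    using that unfolding tri_packing_def by force
qed

lemma finite_cover_sizes:
  assumes "finite E"
  shows "finite {card Y | Y. Y \<subseteq> E \<and> triangle_free (E - Y)}"
proof -
  have "{card Y | Y. Y \<subseteq> E \<and> triangle_free (E - Y)} \<subseteq> card ` Pow E" by blast
  then show ?thesis using finite_subset assms by blast
qed

lemma tri_cover_le:
  assumes "finite E" "Y \<subseteq> E" "triangle_free (E - Y)"
  shows "tri_cover E \<le> card Y"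
  unfolding tri_cover_def using assms by (intro Min_le finite_cover_sizes) auto

lemma tri_cover_witness:
  assumes "finite E"
  obtains Y where "Y \<subseteq> E" "triangle_free (E - Y)" "card Y = tri_cover E"
proof -
  have "{card Y | Y. Y \<subseteq> E \<and> triangle_free (E - Y)} \<noteq> {}"
    by (auto intro!: exI[of _ E] simp: triangle_free_def triangles_def)
  from Min_in[OF finite_cover_sizes[OF assms] this] show thesis
    using that unfolding tri_cover_def by force
qed

section \<open>Deletions that preserve the inequality\<close>

lemma tuza_remove_triangleless_edge:
  assumes "\<And>T. T \<in> triangles E \<Longrightarrow> e \<notin> T" "finite E"
    and "tri_cover (E - {e}) \<le> 2 * tri_packing (E - {e})"
  shows "tri_cover E \<le> 2 * tri_packing E"
proof -
  have tri: "triangles (E - {e}) = triangles E"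
    using assms(1) triangles_mono[of "E - {e}" E] triangles_diffI[of _ E "{e}"] by blast
  obtain Y where Y: "Y \<subseteq> E - {e}" "triangle_free (E - {e} - Y)" "card Y = tri_cover (E - {e})"
    using tri_cover_witness[of "E - {e}"] assms(2) by auto
  have "triangles (E - Y) \<subseteq> triangles (E - {e} - Y)"
  proof
    fix T assume T: "T \<in> triangles (E - Y)"
    then have "T \<in> triangles E" using triangles_mono[of "E - Y" E] by auto
    then have "T \<in> triangles (E - Y - {e})"
      using assms(1) T by (intro triangles_diffI[of T "E - Y" "{e}"]) auto
    moreover have "E - Y - {e} = E - {e} - Y" by auto
    ultimately show "T \<in> triangles (E - {e} - Y)" by simp
  qed
  then have "tri_cover E \<le> card Y"
    using Y assms(2) by (intro tri_cover_le) (auto simp: triangle_free_def)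
  then show ?thesis
    using assms(3) Y tri by (simp add: tri_packing_def)
qed

text \<open>\<open>X\<close> may contain pairs outside \<open>E\<close>: a certificate can then
  delete a pair whose adjacency is undecided, which saves a case split.\<close>

definition reducer :: "'a set set \<Rightarrow> 'a set set set \<Rightarrow> 'a set set \<Rightarrow> bool" where
  "reducer E S X \<longleftrightarrow> S \<noteq> {} \<and> S \<subseteq> triangles E \<and> pairwise disjnt S \<and> finite X \<and>
     card X \<le> 2 * card S \<and>
     (\<forall>T \<in> triangles E. T \<inter> \<Union>S \<noteq> {} \<longrightarrow> T \<inter> X \<noteq> {})"

text \<open>An optimal cover of the remaining graph is completed by \<open>X\<close>, an optimal
  packing of it by \<open>S\<close>; the bound \<open>card X \<le> 2 * card S\<close> matches the
  factor 2 of the claim.\<close>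

lemma tuza_reducer:
  assumes red: "reducer E S X" and fin: "finite E"
    and le: "tri_cover (E - \<Union>S - X) \<le> 2 * tri_packing (E - \<Union>S - X)"
  shows "tri_cover E \<le> 2 * tri_packing E"
proof -
  let ?E = "E - \<Union>S - X"
  have S: "S \<subseteq> triangles E" "pairwise disjnt S" "finite X" "card X \<le> 2 * card S"
    and hit: "\<And>T. T \<in> triangles E \<Longrightarrow> T \<inter> \<Union>S \<noteq> {} \<Longrightarrow> T \<inter> X \<noteq> {}"
    using red unfolding reducer_def by auto
  obtain Y where Y: "Y \<subseteq> ?E" "triangle_free (?E - Y)" "card Y = tri_cover ?E"
    using tri_cover_witness[of ?E] fin by auto
  obtain R where R: "R \<subseteq> triangles ?E" "pairwise disjnt R" "card R = tri_packing ?E"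
    using tri_packing_witness[of ?E] fin by auto
  have "triangle_free (E - (Y \<union> X \<inter> E))"
  proof (rule ccontr)
    assume "\<not> triangle_free (E - (Y \<union> X \<inter> E))"
    then obtain T where T: "T \<in> triangles (E - (Y \<union> X \<inter> E))"
      unfolding triangle_free_def by auto
    then have TE: "T \<in> triangles E" "T \<inter> Y = {}" "T \<inter> X = {}"
      using triangles_mono[of "E - (Y \<union> X \<inter> E)" E] triangles_subsetD[OF T] by auto
    \<comment> \<open>A triangle missed by \<open>X\<close> shares no edge with \<open>S\<close>, so
      it survives in \<open>?E\<close>, where \<open>Y\<close> has to meet it.\<close>
    then have "T \<inter> \<Union>S = {}" using hit by blast
    then have "T \<in> triangles (?E - Y)"
      using TE by (intro triangles_diffI)
    then show False using Y by (simp add: triangle_free_def)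
  qed
  then have "tri_cover E \<le> card (Y \<union> X \<inter> E)"
    using fin Y by (intro tri_cover_le) auto
  also have "\<dots> \<le> card Y + card (X \<inter> E)" by (rule card_Un_le)
  also have "\<dots> \<le> card Y + card X" using S by (simp add: card_mono)
  also have "\<dots> \<le> 2 * (card R + card S)" using Y R S le by simp
  also have "card R + card S = card (R \<union> S)"
  proof (rule card_Un_disjoint[symmetric])
    show "finite R" "finite S"
      using R(1) S(1) fin by (auto intro: finite_subset[OF _ finite_triangles])
    show "R \<inter> S = {}"
    proof (rule ccontr)
      assume "R \<inter> S \<noteq> {}"
      then obtain T where "T \<in> R" "T \<in> S" by auto
      then have T: "T \<in> triangles ?E" "T \<subseteq> \<Union>S" using R(1) by auto
      then show False using triangles_subsetD[OF T(1)] triangles_nonempty[OF T(1)] by blast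
    qed
  qed
  also have "2 * card (R \<union> S) \<le> 2 * tri_packing E"
  proof -
    have "pairwise disjnt (R \<union> S)"
    proof -
      have "disjnt T T'" if "T \<in> R" "T' \<in> S" for T T'
        using that R triangles_subsetD[of T ?E] by (auto simp: disjnt_def)
      then show ?thesis using R(2) S(2) unfolding pairwise_def by (metis Un_iff disjnt_sym)
    qed
    moreover have "R \<union> S \<subseteq> triangles E"
      using R S triangles_mono[of ?E E] by auto
    ultimately show ?thesis using fin by (simp add: tri_packing_ge)
  qed
  finally show ?thesis .
qed

section \<open>Certificates of reducibility\<close>

text \<open>
  A certificate speaks about a graph through finitely many vertices, named by indices: \<open>Split\<close>
  branches on whether two of them are adjacent, and each leaf is contradictory in an irreducible
  graph. \<open>Reduce\<close> exhibits a reducer, \<open>Matching\<close> a vertex with two non-neighbours in the link of a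
  vertex whose link is complete up to a matching, \<open>Isolated\<close> an edge in no triangle.
\<close>

datatype certificate =
    Split nat nat certificate certificate
  | Reduce "(nat \<times> nat \<times> nat) list" "(nat \<times> nat) list"
  | Matching nat nat nat nat
  | Isolated nat nat

text \<open>Edges and non-edges are stored as increasing pairs, so a query first sorts its
  arguments.\<close>

definition listed :: "(nat \<times> nat) list \<Rightarrow> nat \<Rightarrow> nat \<Rightarrow> bool" where
  "listed es a b \<longleftrightarrow> (if a < b then (a, b) \<in> set es else (b, a) \<in> set es)"

fun tri_edges :: "(nat \<times> nat \<times> nat) list \<Rightarrow> (nat \<times> nat) list" where
  "tri_edges [] = []"
| "tri_edges ((a, b, c) # S) = (a, b) # (a, c) # (b, c) # tri_edges S"

text \<open>
  In \<open>check vs U L P A\<close> the vertices \<open>U\<close> have all their neighbours among \<open>vs\<close>, the vertices \<open>L\<close>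
  have links that are complete up to a matching, and \<open>P\<close> and \<open>A\<close> are known edges and non-edges.
  An edge that misses \<open>U\<close> may lie in unknown triangles, so \<open>Reduce\<close> has to delete it. The nested
  conditionals only make the evaluation lazy.
\<close>

fun check :: "nat list \<Rightarrow> nat list \<Rightarrow> nat list \<Rightarrow> (nat \<times> nat) list \<Rightarrow> (nat \<times> nat) list \<Rightarrow>
    certificate \<Rightarrow> bool" where
  "check vs U L P A (Split a b t1 t2) \<longleftrightarrow>
     (if check vs U L ((a, b) # P) A t1 then check vs U L P ((a, b) # A) t2 else False)"
| "check vs U L P A (Reduce S X) \<longleftrightarrow>
     S \<noteq> [] \<and> length X \<le> 2 * length S \<and> distinct (tri_edges S) \<and>
     list_all (\<lambda>(a, b, c). a < b \<and> b < c \<and> a \<in> set vs \<and> b \<in> set vs \<and> c \<in> set vs) S \<and>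
     list_all (\<lambda>(a, b). (a, b) \<in> set P \<and>
       (if (a, b) \<in> set X then True
        else (a \<in> set U \<or> b \<in> set U) \<and>
          list_all (\<lambda>c. if c = a then True else if c = b then True
            else if listed X a c then True else if listed X b c then True
            else if listed A a c then True else listed A b c) vs)) (tri_edges S)"
| "check vs U L P A (Matching u a b c) \<longleftrightarrow>
     u \<in> set L \<and> distinct [a, b, c] \<and> a \<in> set vs \<and> b \<in> set vs \<and> c \<in> set vs \<and>
     listed P u a \<and> listed P u b \<and> listed P u c \<and> listed A a b \<and> listed A a c"
| "check vs U L P A (Isolated u a) \<longleftrightarrow>
     u \<in> set U \<and> listed P u a \<and>
     list_all (\<lambda>c. c = u \<or> c = a \<or> listed A u c \<or> listed A a c) vs"

definition refutes :: "nat \<Rightarrow> nat list \<Rightarrow> nat list \<Rightarrow> (nat \<times> nat) list \<Rightarrow> (nat \<times> nat) list \<Rightarrow>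
    certificate \<Rightarrow> bool" where
  "refutes n U L P A t \<longleftrightarrow> check [0..<n] U L P A t"

lemma listedD: "listed es a b \<Longrightarrow> (a, b) \<in> set es \<or> (b, a) \<in> set es"
  by (auto simp: listed_def split: if_splits)

text \<open>An increasing index pair determines its edge, so distinctness of the list of pairs
  already gives edge-disjoint triangles. The map \<open>g\<close> will send index pairs to edges;
  reversed pairs have the same image, hence injectivity on increasing pairs.\<close>

lemma tri_edges_disjoint:
  assumes "inj_on g {(a, b). a < b \<and> b < n}"
    and "distinct (tri_edges S)"
    and "\<forall>(a, b, c) \<in> set S. a < b \<and> b < c \<and> c < (n :: nat)"
  defines "tri \<equiv> \<lambda>(a, b, c). {g (a, b), g (a, c), g (b, c)}"
  shows "pairwise disjnt (tri ` set S) \<and> card (tri ` set S) = length S \<and>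
    \<Union>(tri ` set S) = g ` set (tri_edges S) \<and> set (tri_edges S) \<subseteq> {(a, b). a < b \<and> b < n}"
  using assms(2,3)
proof (induction S)
  case Nil
  then show ?case by simp
next
  case (Cons s S)
  obtain a b c where s: "s = (a, b, c)" by (cases s)
  have "distinct (tri_edges S)" "\<forall>(a, b, c) \<in> set S. a < b \<and> b < c \<and> c < n"
    using Cons.prems s by simp_all
  from Cons.IH[OF this]
  have IH: "pairwise disjnt (tri ` set S)" "card (tri ` set S) = length S"
    "\<Union>(tri ` set S) = g ` set (tri_edges S)" "set (tri_edges S) \<subseteq> {(a, b). a < b \<and> b < n}"
    by - (elim conjE, assumption)+
  have abc: "a < b" "b < c" "c < n" using Cons.prems(2) s by simp_all
  have tri_s: "tri s = g ` {(a, b), (a, c), (b, c)}" by (simp add: s tri_def)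
  have new: "{(a, b), (a, c), (b, c)} \<inter> set (tri_edges S) = {}"
    using Cons.prems(1) s by auto
  have "{(a, b), (a, c), (b, c)} \<subseteq> {(a, b). a < b \<and> b < n}"
    using abc by auto
  from inj_on_image_Int[OF assms(1) this IH(4)]
  have "tri s \<inter> g ` set (tri_edges S) = {}"
    unfolding tri_s new by simp
  then have disj: "disjnt (tri s) T" if "T \<in> tri ` set S" for T
    using that IH(3) unfolding disjnt_def by blast
  \<comment> \<open>Disjoint sets may coincide if they are empty; nonemptiness makes the new
    triangle count in the cardinality.\<close>
  have "tri s \<noteq> {}" by (simp add: s tri_def)
  then have "tri s \<notin> tri ` set S" using disj by (metis disjnt_self_iff_empty)
  then have "card (tri ` set (s # S)) = length (s # S)" using IH(2) by simp
  moreover have "pairwise disjnt (tri ` set (s # S))"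
    using IH(1) disj by (auto simp: pairwise_insert disjnt_sym)
  moreover have "\<Union>(tri ` set (s # S)) = g ` set (tri_edges (s # S))"
    using IH(3) by (auto simp: s tri_def)
  moreover have "set (tri_edges (s # S)) \<subseteq> {(a, b). a < b \<and> b < n}"
    using IH(4) abc by (auto simp: s)
  ultimately show ?case by blast
qed

text \<open>The assumptions say that neither kind of deletion applies. Minimality and
  \<open>mad\<close> stay outside, so the local analysis needs no induction and ends in a bound on
  the average degree.\<close>

locale irreducible_graph =
  fixes V :: "'a set" and E :: "'a set set"
  assumes graph: "simple_graph V E"
    and edge_in_triangle: "e \<in> E \<Longrightarrow> \<exists>T \<in> triangles E. e \<in> T"
    and irreducible: "\<not> reducer E S X"
begin

definition nbrs :: "'a \<Rightarrow> 'a set" where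
  "nbrs v = {w. {v, w} \<in> E}"

abbreviation deg :: "'a \<Rightarrow> nat" where
  "deg v \<equiv> card (nbrs v)"

text \<open>The complement of the link has maximum degree at most 1. The form with three vertices is
  what a \<open>Matching\<close> leaf contradicts.\<close>

definition matching_link :: "'a \<Rightarrow> bool" where
  "matching_link v \<longleftrightarrow> (\<forall>a b c. a \<in> nbrs v \<longrightarrow> b \<in> nbrs v \<longrightarrow> c \<in> nbrs v \<longrightarrow>
     distinct [a, b, c] \<longrightarrow> {a, b} \<in> E \<or> {a, c} \<in> E)"

lemma edgeD: "{a, b} \<in> E \<Longrightarrow> a \<noteq> b \<and> a \<in> V \<and> b \<in> V"
  using graph unfolding simple_graph_def by (fastforce simp: doubleton_eq_iff)

lemma nbrs_sym: "w \<in> nbrs v \<longleftrightarrow> v \<in> nbrs w"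
  by (simp add: nbrs_def insert_commute)

lemma not_self_nbr [simp]: "v \<notin> nbrs v"
  using edgeD[of v v] by (auto simp: nbrs_def)

lemma finite_V: "finite V"
  using graph by (simp add: simple_graph_def)

lemma finite_nbrs [simp]: "finite (nbrs v)"
  using finite_V edgeD by (auto simp: nbrs_def intro: finite_subset[of _ V])

lemma finite_E: "finite E"
  using finite_V edgeD graph unfolding simple_graph_def
  by (intro finite_subset[of E "Pow V"]) auto

lemma edge_common_nbr:
  assumes "{a, b} \<in> E"
  obtains c where "c \<in> nbrs a" "c \<in> nbrs b"
proof -
  obtain T where "T \<in> triangles E" "{a, b} \<in> T" using edge_in_triangle[OF assms] by auto
  then show thesis using that by (elim triangleE) (auto simp: nbrs_def)
qed

text \<open>\<open>xs\<close> realises the indices by distinct vertices. All neighbours of a vertex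
  in \<open>U\<close> occur in \<open>xs\<close>, so every triangle through such a vertex lies
  within \<open>xs\<close>, and a test over finitely many indices sees all of them.\<close>

lemma check_sound:
  assumes "check [0..<length xs] U L P A t" "distinct xs"
    and "\<forall>u \<in> set U. u < length xs \<and> nbrs (xs ! u) \<subseteq> set xs"
    and "\<forall>u \<in> set L. matching_link (xs ! u)"
    and "\<forall>(a, b) \<in> set P. {xs ! a, xs ! b} \<in> E"
    and "\<forall>(a, b) \<in> set A. {xs ! a, xs ! b} \<notin> E"
  shows False
  using assms
proof (induction t arbitrary: P A)
  case (Split a b t1 t2)
  show ?case
  proof (cases "{xs ! a, xs ! b} \<in> E")
    case True
    with Split show False by (intro Split.IH(1)[of "(a, b) # P" A]) (auto split: if_splits)
  next
    case False
    with Split show False by (intro Split.IH(2)[of P "(a, b) # A"]) (auto split: if_splits)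
  qed
next
  case (Matching u a b c)
  have "{xs ! u, xs ! a} \<in> E" "{xs ! u, xs ! b} \<in> E" "{xs ! u, xs ! c} \<in> E"
    "{xs ! a, xs ! b} \<notin> E" "{xs ! a, xs ! c} \<notin> E"
    using Matching by (auto dest!: listedD simp: insert_commute)
  moreover have "distinct [xs ! a, xs ! b, xs ! c]"
    using Matching by (auto simp: nth_eq_iff_index_eq)
  moreover have "matching_link (xs ! u)" using Matching by auto
  ultimately show ?case unfolding matching_link_def nbrs_def by blast
next
  case (Isolated u a)
  have "{xs ! u, xs ! a} \<in> E"
    using Isolated by (auto dest!: listedD simp: insert_commute)
  \<comment> \<open>The third vertex of a triangle on this edge is a neighbour of a vertex in
    \<open>U\<close>, hence an index; the known non-edges exclude every index.\<close>
  then obtain r where r: "r \<in> nbrs (xs ! u)" "r \<in> nbrs (xs ! a)" by (elim edge_common_nbr)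
  then obtain c where c: "c < length xs" "r = xs ! c"
    using Isolated by (auto simp: in_set_conv_nth) (metis in_set_conv_nth subsetD)
  then have "c \<noteq> u" "c \<noteq> a" using r by auto
  then have "listed A u c \<or> listed A a c" using Isolated c by (auto simp: list_all_iff)
  then show ?case
    using r c Isolated.prems(6) by (auto dest!: listedD simp: nbrs_def insert_commute)
next
  case (Reduce S X)
  define n where "n = length xs"
  define g where "g = (\<lambda>(a, b). {xs ! a, xs ! b})"
  define tri where "tri = (\<lambda>(a, b, c). {g (a, b), g (a, c), g (b, c)})"
  have inj: "inj_on g {(a, b). a < b \<and> b < n}"
    using \<open>distinct xs\<close> by (auto simp: inj_on_def g_def n_def doubleton_eq_iff nth_eq_iff_index_eq)
  have lt: "\<forall>(a, b, c) \<in> set S. a < b \<and> b < c \<and> c < n"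
    using Reduce.prems(1) by (auto simp: list_all_iff n_def)
  have "distinct (tri_edges S)" using Reduce.prems(1) by simp
  from tri_edges_disjoint[OF inj this lt]
  have S: "pairwise disjnt (tri ` set S)" "card (tri ` set S) = length S"
    "\<Union>(tri ` set S) = g ` set (tri_edges S)" "set (tri_edges S) \<subseteq> {(a, b). a < b \<and> b < n}"
    unfolding tri_def by - (elim conjE, assumption)+
  have edges: "\<And>a b. (a, b) \<in> set (tri_edges S) \<Longrightarrow> {xs ! a, xs ! b} \<in> E"
    using Reduce.prems(1,5) by (auto simp: list_all_iff)
  have in_edges: "(a, b) \<in> set (tri_edges S) \<and> (a, c) \<in> set (tri_edges S) \<and> (b, c) \<in> set (tri_edges S)"
    if "(a, b, c) \<in> set S" for a b c S
    using that by (induction S rule: tri_edges.induct) auto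
  have "tri s \<in> triangles E" if "s \<in> set S" for s
  proof -
    obtain a b c where s: "s = (a, b, c)" by (cases s)
    then have "a < b" "b < c" "c < n" using lt that by auto
    then have "xs ! a \<noteq> xs ! b" "xs ! b \<noteq> xs ! c" "xs ! a \<noteq> xs ! c"
      using \<open>distinct xs\<close> by (auto simp: n_def nth_eq_iff_index_eq)
    moreover have "tri s = {{xs ! a, xs ! b}, {xs ! b, xs ! c}, {xs ! a, xs ! c}}"
      by (auto simp: tri_def g_def s)
    moreover have "tri s \<subseteq> E"
      using in_edges[of a b c S] edges that by (auto simp: tri_def g_def s)
    ultimately show ?thesis unfolding triangles_def by blast
  qed
  moreover have "T \<inter> g ` set X \<noteq> {}" if T: "T \<in> triangles E" "T \<inter> \<Union>(tri ` set S) \<noteq> {}" for T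
  proof -
    obtain a b where ab: "(a, b) \<in> set (tri_edges S)" "{xs ! a, xs ! b} \<in> T"
      using T(2) S(3) by (auto simp: g_def)
    show ?thesis
    proof (cases "(a, b) \<in> set X")
      case True
      then show ?thesis using ab by (force simp: g_def)
    next
      case False
      then have U: "a \<in> set U \<or> b \<in> set U"
        and c: "\<And>c. c < n \<Longrightarrow> c \<noteq> a \<Longrightarrow> c \<noteq> b \<Longrightarrow>
          listed X a c \<or> listed X b c \<or> listed A a c \<or> listed A b c"
        using Reduce.prems(1) ab by (fastforce simp: list_all_iff n_def split: if_splits)+
      obtain r where r: "r \<noteq> xs ! a" "r \<noteq> xs ! b"
        "T = {{xs ! a, xs ! b}, {xs ! a, r}, {xs ! b, r}}" "{xs ! a, r} \<in> E" "{xs ! b, r} \<in> E"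
        using T(1) ab(2) by (elim triangleE)
      \<comment> \<open>One end of the edge is in \<open>U\<close>, so the third vertex is an index.
        Known non-edges leave only indices whose edge to \<open>a\<close> or \<open>b\<close> is in
        \<open>X\<close>.\<close>
      then have "r \<in> set xs"
        using U Reduce.prems(3) by (auto simp: nbrs_def)
      then obtain c' where c': "c' < n" "r = xs ! c'" by (auto simp: in_set_conv_nth n_def)
      then have "listed X a c' \<or> listed X b c' \<or> listed A a c' \<or> listed A b c'"
        using c r by auto
      moreover have "\<not> listed A a c'" "\<not> listed A b c'"
        using r c' Reduce.prems(6) by (auto dest!: listedD simp: insert_commute)
      ultimately consider "listed X a c'" | "listed X b c'" by auto
      then have "{xs ! a, r} \<in> g ` set X \<or> {xs ! b, r} \<in> g ` set X"
      proof cases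
        case 1
        then show ?thesis using c'(2) listedD[OF 1] by (force simp: g_def insert_commute[of "xs ! a"])
      next
        case 2
        then show ?thesis using c'(2) listedD[OF 2] by (force simp: g_def insert_commute[of "xs ! b"])
      qed
      then show ?thesis unfolding r(3) by blast
    qed
  qed
  moreover have "card (g ` set X) \<le> 2 * card (tri ` set S)"
  proof -
    have "card (g ` set X) \<le> length X"
      using card_image_le[OF finite_set, of g X] card_length[of X] by linarith
    moreover have "length X \<le> 2 * length S" using Reduce.prems(1) by simp
    ultimately show ?thesis using S(2) by linarith
  qed
  moreover have "tri ` set S \<noteq> {}" using Reduce.prems(1) by simp
  ultimately have "reducer E (tri ` set S) (g ` set X)"
    unfolding reducer_def using S(1) by (intro conjI) auto
  then show False using irreducible by blast
qed

lemma refutes_sound: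
  assumes "refutes n U L P A t" "length xs = n" "distinct xs"
    and "\<forall>u \<in> set U. u < n \<and> nbrs (xs ! u) \<subseteq> set xs"
    and "\<forall>u \<in> set L. matching_link (xs ! u)"
    and "\<forall>(a, b) \<in> set P. {xs ! a, xs ! b} \<in> E"
    and "\<forall>(a, b) \<in> set A. {xs ! a, xs ! b} \<notin> E"
  shows False
  using check_sound[of xs U L P A t] assms by (simp add: refutes_def)

end

section \<open>Refuted configurations\<close>

text \<open>
  The certificates were found by exhaustive search. In a configuration around an edge \<open>uw\<close> the
  indices run through \<open>u\<close>, \<open>w\<close>, the common neighbours, the remaining neighbours of \<open>u\<close> and those of \<open>w\<close>.
\<close>

lemma refute_degree_2:
  "refutes 3 [0] []
    [(0, 1), (0, 2), (1, 2)]
    []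
    (Reduce [(0,1,2)] [(1,2)])"
  by code_simp

text \<open>A second triangle on 01 or 02 must have third vertex 3, so it contains 03.\<close>

lemma refute_degree_3:
  "refutes 4 [0] []
    [(0, 1), (0, 2), (0, 3), (1, 2)]
    []
    (Reduce [(0,1,2)] [(0,3),(1,2)])"
  by code_simp

text \<open>If 34 is an edge, the triangles 012 and 034 serve: only the spokes 03 and 04 survive,
  and 34 is deleted as well. Otherwise another perfect matching of the link or a single triangle
  does it.\<close>

lemma refute_degree_4:
  "refutes 5 [0] []
    [(0, 1), (0, 2), (0, 3), (0, 4), (1, 2)]
    []
    (Split 3 4 (Reduce [(0,1,2),(0,3,4)] [(0,1),(0,2),(1,2),(3,4)]) (Split 2 3 (Split 1 4 (Reduce
    [(0,1,4),(0,2,3)] [(0,1),(0,2),(1,4),(2,3)]) (Split 2 4 (Reduce [(0,2,4)] [(0,2),(2,4)])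
    (Reduce [(0,1,2)] [(0,3),(1,2)]))) (Split 2 4 (Reduce [(0,2,4)] [(0,1),(2,4)]) (Reduce [(0,1,2)]
    [(0,1),(1,2)]))))"
  by code_simp

text \<open>Suppose 14 and 23 are edges. For the triangles 014 and 023 delete 14, 23 and the spokes
  04, 05: the surviving spokes end in 1, 2, 3, between which only 23 could be an edge. The splits
  treat the cases without this matching.\<close>

lemma refute_degree_5_nonmatching:
  "refutes 6 [0] []
    [(0, 1), (0, 2), (0, 3), (0, 4), (0, 5)]
    [(1, 2), (1, 3)]
    (Split 1 4 (Split 1 5 (Split 2 3 (Reduce [(0,1,4),(0,2,3)] [(0,4),(0,5),(1,4),(2,3)]) (Split
    2 5 (Reduce [(0,1,4),(0,2,5)] [(0,4),(0,5),(1,4),(2,5)]) (Split 3 5 (Reduce [(0,1,4),(0,3,5)]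
    [(0,1),(0,4),(1,4),(3,5)]) (Reduce [(0,1,5)] [(0,4),(1,5)])))) (Reduce [(0,1,4)] [(0,4),(1,4)]))
    (Split 1 5 (Reduce [(0,1,5)] [(0,5),(1,5)]) (Isolated 0 1)))"
  by code_simp

text \<open>The device of degree 5 with three triangles: delete the spokes to 4, 5, 6 and a perfect
  matching of the link through 23. The tree is long because such a matching may be missing.\<close>

lemma refute_degree_6_nonmatching:
  "refutes 7 [0] []
    [(0, 1), (0, 2), (0, 3), (0, 4), (0, 5), (0, 6)]
    [(1, 2), (1, 3)]
    (Split 1 4 (Split 1 5 (Split 2 3 (Split 5 6 (Reduce [(0,1,4),(0,2,3),(0,5,6)] [(0,4),(0,5),
    (0,6),(1,4),(2,3),(5,6)]) (Split 4 6 (Reduce [(0,1,5),(0,2,3),(0,4,6)] [(0,4),(0,5),(0,6),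
    (1,5),(2,3),(4,6)]) (Split 2 4 (Split 2 5 (Split 1 6 (Split 4 5 (Reduce [(0,1,6),(0,2,3),
    (0,4,5)] [(0,1),(0,2),(0,3),(1,6),(2,3),(4,5)]) (Split 3 6 (Reduce [(0,1,4),(0,2,5),(0,3,6)]
    [(0,1),(0,2),(0,3),(1,4),(2,5),(3,6)]) (Split 2 6 (Split 3 4 (Reduce [(0,1,5),(0,2,6),(0,3,4)]
    [(0,1),(0,2),(0,3),(1,5),(2,6),(3,4)]) (Reduce [(0,1,4),(0,2,6)] [(0,1),(0,2),(1,4),(2,6)]))
    (Reduce [(0,1,6)] [(0,1),(1,6)])))) (Split 3 4 (Split 3 6 (Reduce [(0,1,4),(0,2,5),(0,3,6)]
    [(0,2),(0,3),(0,5),(1,4),(2,5),(3,6)]) (Split 2 6 (Reduce [(0,1,5),(0,2,6),(0,3,4)] [(0,1),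
    (0,2),(0,5),(1,5),(2,6),(3,4)]) (Reduce [(0,1,4),(0,2,3)] [(0,4),(0,5),(1,4),(2,3)]))) (Reduce
    [(0,1,4),(0,2,5)] [(0,2),(0,5),(1,4),(2,5)]))) (Split 3 5 (Split 2 6 (Reduce [(0,1,4),(0,2,6),
    (0,3,5)] [(0,1),(0,3),(0,4),(1,4),(2,6),(3,5)]) (Split 1 6 (Reduce [(0,1,6),(0,2,4),(0,3,5)]
    [(0,1),(0,3),(0,4),(1,6),(2,4),(3,5)]) (Reduce [(0,1,5),(0,2,3)] [(0,3),(0,4),(1,5),(2,3)])))
    (Reduce [(0,1,5),(0,2,3)] [(0,4),(0,6),(1,5),(2,3)]))) (Split 3 4 (Split 2 6 (Reduce [(0,1,5),
    (0,2,6),(0,3,4)] [(0,1),(0,3),(0,5),(1,5),(2,6),(3,4)]) (Split 1 6 (Split 3 6 (Split 2 5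
    (Reduce [(0,1,4),(0,2,5),(0,3,6)] [(0,1),(0,3),(0,4),(1,4),(2,5),(3,6)]) (Reduce [(0,1,6),
    (0,2,3)] [(0,1),(0,3),(1,6),(2,3)])) (Reduce [(0,1,6)] [(0,1),(1,6)])) (Reduce [(0,1,4),(0,2,3)]
    [(0,3),(0,5),(1,4),(2,3)]))) (Reduce [(0,1,4),(0,2,3)] [(0,5),(0,6),(1,4),(2,3)]))))) (Split
    2 5 (Split 3 6 (Reduce [(0,1,4),(0,2,5),(0,3,6)] [(0,4),(0,5),(0,6),(1,4),(2,5),(3,6)]) (Split
    2 4 (Split 1 6 (Split 2 6 (Split 3 5 (Reduce [(0,1,4),(0,2,6),(0,3,5)] [(0,1),(0,4),(0,5),
    (1,4),(2,6),(3,5)]) (Split 3 4 (Reduce [(0,1,5),(0,2,6),(0,3,4)] [(0,1),(0,4),(0,5),(1,5),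
    (2,6),(3,4)]) (Isolated 0 3))) (Reduce [(0,1,6),(0,2,4)] [(0,4),(0,5),(1,6),(2,4)])) (Split
    2 6 (Reduce [(0,1,4),(0,2,6)] [(0,4),(0,5),(1,4),(2,6)]) (Reduce [(0,1,4),(0,2,5)] [(0,4),
    (0,5),(1,4),(2,5)]))) (Split 3 4 (Split 2 6 (Reduce [(0,1,5),(0,2,6),(0,3,4)] [(0,1),(0,4),
    (0,5),(1,5),(2,6),(3,4)]) (Reduce [(0,2,5)] [(0,5),(2,5)])) (Reduce [(0,1,4),(0,2,5)] [(0,5),
    (0,6),(1,4),(2,5)])))) (Split 2 6 (Split 3 5 (Reduce [(0,1,4),(0,2,6),(0,3,5)] [(0,1),(0,4),
    (0,6),(1,4),(2,6),(3,5)]) (Reduce [(0,1,5),(0,2,6)] [(0,4),(0,6),(1,5),(2,6)])) (Split 2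
    4 (Reduce [(0,2,4)] [(0,4),(2,4)]) (Isolated 0 2))))) (Split 1 6 (Split 2 3 (Split 5 6 (Reduce
    [(0,1,4),(0,2,3),(0,5,6)] [(0,4),(0,5),(0,6),(1,4),(2,3),(5,6)]) (Split 4 5 (Reduce [(0,1,6),
    (0,2,3),(0,4,5)] [(0,2),(0,3),(0,4),(1,6),(2,3),(4,5)]) (Split 2 4 (Split 3 6 (Split 2 5
    (Reduce [(0,1,4),(0,2,5),(0,3,6)] [(0,2),(0,3),(0,6),(1,4),(2,5),(3,6)]) (Split 3 5 (Reduce
    [(0,1,6),(0,2,4),(0,3,5)] [(0,1),(0,3),(0,6),(1,6),(2,4),(3,5)]) (Reduce [(0,1,4),(0,2,3)]
    [(0,4),(0,6),(1,4),(2,3)]))) (Reduce [(0,1,6),(0,2,4)] [(0,2),(0,4),(1,6),(2,4)])) (Split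
    3 4 (Split 2 5 (Reduce [(0,1,4),(0,2,5)] [(0,3),(0,6),(1,4),(2,5)]) (Reduce [(0,1,4),(0,2,3)]
    [(0,3),(0,6),(1,4),(2,3)])) (Reduce [(0,1,4)] [(0,6),(1,4)]))))) (Split 2 5 (Split 3 5 (Split
    3 6 (Reduce [(0,1,4),(0,2,5),(0,3,6)] [(0,3),(0,4),(0,6),(1,4),(2,5),(3,6)]) (Split 2 6 (Reduce
    [(0,1,4),(0,2,6),(0,3,5)] [(0,1),(0,4),(0,5),(1,4),(2,6),(3,5)]) (Reduce [(0,1,6),(0,2,5)]
    [(0,4),(0,5),(1,6),(2,5)]))) (Reduce [(0,1,4),(0,2,5)] [(0,4),(0,6),(1,4),(2,5)])) (Split
    2 6 (Reduce [(0,1,4),(0,2,6)] [(0,4),(0,6),(1,4),(2,6)]) (Split 3 5 (Reduce [(0,1,4),(0,3,5)]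
    [(0,4),(0,6),(1,4),(3,5)]) (Split 3 6 (Reduce [(0,1,4),(0,3,6)] [(0,4),(0,6),(1,4),(3,6)])
    (Split 5 6 (Reduce [(0,1,4),(0,5,6)] [(0,1),(0,4),(1,4),(5,6)]) (Reduce [(0,1,6)] [(0,4),
    (1,6)]))))))) (Reduce [(0,1,4)] [(0,4),(1,4)]))) (Split 1 5 (Split 1 6 (Split 2 3 (Split
    4 6 (Reduce [(0,1,5),(0,2,3),(0,4,6)] [(0,4),(0,5),(0,6),(1,5),(2,3),(4,6)]) (Split 4 5 (Reduce
    [(0,1,6),(0,2,3),(0,4,5)] [(0,2),(0,3),(0,5),(1,6),(2,3),(4,5)]) (Split 2 5 (Split 3 6 (Split
    2 4 (Reduce [(0,1,5),(0,2,4),(0,3,6)] [(0,2),(0,3),(0,6),(1,5),(2,4),(3,6)]) (Split 3 4 (Reduce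
    [(0,1,6),(0,2,5),(0,3,4)] [(0,1),(0,3),(0,6),(1,6),(2,5),(3,4)]) (Reduce [(0,1,5),(0,2,3)]
    [(0,5),(0,6),(1,5),(2,3)]))) (Reduce [(0,1,6),(0,2,5)] [(0,2),(0,5),(1,6),(2,5)])) (Split
    3 5 (Split 2 4 (Reduce [(0,1,5),(0,2,4)] [(0,3),(0,6),(1,5),(2,4)]) (Reduce [(0,1,5),(0,2,3)]
    [(0,3),(0,6),(1,5),(2,3)])) (Reduce [(0,1,5)] [(0,6),(1,5)]))))) (Split 2 4 (Split 3 4 (Split
    3 6 (Reduce [(0,1,5),(0,2,4),(0,3,6)] [(0,3),(0,5),(0,6),(1,5),(2,4),(3,6)]) (Split 2 6 (Reduce
    [(0,1,5),(0,2,6),(0,3,4)] [(0,1),(0,4),(0,5),(1,5),(2,6),(3,4)]) (Reduce [(0,1,6),(0,2,4)]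
    [(0,4),(0,5),(1,6),(2,4)]))) (Reduce [(0,1,5),(0,2,4)] [(0,5),(0,6),(1,5),(2,4)])) (Split
    2 6 (Reduce [(0,1,5),(0,2,6)] [(0,5),(0,6),(1,5),(2,6)]) (Split 3 4 (Reduce [(0,1,5),(0,3,4)]
    [(0,5),(0,6),(1,5),(3,4)]) (Split 3 6 (Reduce [(0,1,5),(0,3,6)] [(0,5),(0,6),(1,5),(3,6)])
    (Split 4 6 (Reduce [(0,1,5),(0,4,6)] [(0,1),(0,5),(1,5),(4,6)]) (Reduce [(0,1,6)] [(0,5),
    (1,6)]))))))) (Reduce [(0,1,5)] [(0,5),(1,5)])) (Split 1 6 (Reduce [(0,1,6)] [(0,6),(1,6)])
    (Isolated 0 1))))"
  by code_simp

section \<open>Adjacent low vertices\<close>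

lemma refute_5_5_twins:
  "refutes 6 [0, 1] [0, 1]
    [(0, 1), (0, 2), (0, 3), (0, 4), (0, 5), (1, 2), (1, 3), (1, 4), (1, 5)]
    []
    (Split 2 4 (Split 2 5 (Reduce [(0,1,3),(0,2,4),(1,2,5)] [(0,1),(0,3),(1,3),(2,4),(2,5),(4,5)])
    (Split 2 3 (Split 3 5 (Split 4 5 (Reduce [(0,1,2),(0,3,5),(1,4,5)] [(0,1),(0,2),(1,2),(3,4),
    (3,5),(4,5)]) (Matching 0 5 2 4)) (Matching 0 5 2 3)) (Matching 0 2 3 5))) (Split 2 5 (Split
    2 3 (Split 3 4 (Split 4 5 (Reduce [(0,1,2),(0,3,4),(1,4,5)] [(0,1),(0,2),(1,2),(3,4),(3,5),
    (4,5)]) (Matching 0 4 2 5)) (Matching 0 4 2 3)) (Matching 0 2 3 4)) (Reduce [(0,1,2)] [(0,1),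
    (2,3)])))"
  by code_simp

text \<open>In the link of 0 the private neighbour 5 already misses 1, so it is joined to 2, 3, 4;
  likewise 6 in the link of 1. After that a single reducer serves.\<close>

lemma refute_5_5:
  "refutes 7 [0, 1] [0, 1]
    [(0, 1), (0, 2), (0, 3), (0, 4), (0, 5), (1, 2), (1, 3), (1, 4), (1, 6)]
    [(0, 6), (1, 5)]
    (Split 2 5 (Split 3 5 (Split 4 5 (Split 2 6 (Split 3 6 (Split 4 6 (Reduce [(0,1,2),(0,3,5),
    (1,4,6)] [(0,2),(0,4),(1,2),(1,3),(3,5),(4,6)]) (Matching 1 6 0 4)) (Matching 1 6 0 3)) (Matching
    1 6 0 2)) (Matching 0 5 1 4)) (Matching 0 5 1 3)) (Matching 0 5 1 2))"
  by code_simp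

text \<open>In the link of 1 the vertex 6 already misses 0, so it is joined to 2, 3, 4, 5; the other
  splits concern only pairs among 2, 3, 4, 5.\<close>

lemma refute_5_6:
  "refutes 7 [0, 1] [0, 1]
    [(0, 1), (0, 2), (0, 3), (0, 4), (0, 5), (1, 2), (1, 3), (1, 4), (1, 5), (1, 6)]
    [(0, 6)]
    (Split 2 6 (Split 3 6 (Split 4 6 (Split 5 6 (Split 3 4 (Split 3 5 (Reduce [(0,1,2),(0,3,4),
    (1,3,5),(1,4,6)] [(0,1),(0,2),(1,2),(1,6),(3,4),(3,5),(4,5),(4,6)]) (Split 2 3 (Split 2 5
    (Split 4 5 (Reduce [(0,1,2),(0,3,4),(1,3,6),(1,4,5)] [(0,1),(0,2),(1,2),(1,4),(1,5),(3,4),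
    (3,6),(4,5)]) (Matching 0 5 3 4)) (Matching 0 5 2 3)) (Matching 0 3 2 5))) (Split 2 3 (Split
    3 5 (Split 2 4 (Split 4 5 (Reduce [(0,1,2),(0,3,5),(1,3,6),(1,4,5)] [(0,1),(0,2),(1,2),(1,4),
    (1,5),(3,5),(3,6),(4,5)]) (Matching 0 4 3 5)) (Matching 0 4 2 3)) (Matching 0 3 4 5)) (Matching
    0 3 2 4))) (Matching 1 6 0 5)) (Matching 1 6 0 4)) (Matching 1 6 0 3)) (Matching 1 6 0 2))"
  by code_simp

lemma refute_6_6_twins:
  "refutes 7 [0, 1] [0, 1]
    [(0, 1), (0, 2), (0, 3), (0, 4), (0, 5), (0, 6), (1, 2), (1, 3), (1, 4), (1, 5), (1, 6)]
    []
    (Split 2 4 (Split 2 3 (Split 2 6 (Split 2 5 (Split 4 5 (Split 5 6 (Reduce [(0,1,3),(0,2,4),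
    (0,5,6),(1,2,6),(1,4,5)] [(0,1),(0,2),(0,3),(1,2),(1,3),(2,4),(2,6),(4,5),(4,6),(5,6)]) (Split
    3 5 (Split 3 6 (Split 4 6 (Reduce [(0,1,2),(0,3,5),(0,4,6),(1,3,6)] [(0,1),(0,2),(0,4),(1,2),
    (1,3),(3,5),(3,6),(4,6)]) (Matching 0 6 4 5)) (Matching 0 6 3 5)) (Matching 0 5 3 6))) (Split
    5 6 (Reduce [(0,1,3),(0,2,4),(0,5,6),(1,2,5)] [(0,1),(0,3),(0,6),(1,2),(1,3),(2,4),(2,5),
    (5,6)]) (Matching 0 5 4 6))) (Split 5 6 (Reduce [(0,1,3),(0,2,4),(0,5,6),(1,2,6)] [(0,1),
    (0,3),(0,5),(1,3),(2,4),(2,6),(4,6),(5,6)]) (Matching 0 5 2 6))) (Split 4 6 (Reduce [(0,1,5),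
    (0,2,3),(0,4,6),(1,2,4)] [(0,1),(0,5),(0,6),(1,5),(2,3),(2,4),(3,4),(4,6)]) (Matching 0 6
    2 4))) (Split 2 5 (Split 2 6 (Split 3 4 (Split 3 5 (Split 3 6 (Reduce [(0,1,4),(0,2,5),(0,3,6),
    (1,2,6)] [(0,1),(0,3),(0,4),(1,4),(2,5),(2,6),(3,6),(5,6)]) (Matching 0 3 2 6)) (Matching
    0 3 2 5)) (Matching 0 3 2 4)) (Matching 0 2 3 6)) (Split 2 6 (Matching 0 2 3 5) (Reduce [(0,1,2)]
    [(0,1),(2,4)])))) (Split 2 5 (Split 2 3 (Split 2 6 (Split 3 4 (Split 4 5 (Split 4 6 (Reduce
    [(0,1,3),(0,2,5),(0,4,6),(1,2,6)] [(0,1),(0,3),(0,4),(1,3),(2,5),(2,6),(4,6),(5,6)]) (Matching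
    0 4 2 6)) (Matching 0 4 2 5)) (Matching 0 4 2 3)) (Matching 0 2 4 6)) (Matching 0 2 3 4))
    (Split 2 6 (Matching 0 2 4 5) (Reduce [(0,1,2)] [(0,1),(2,3)]))))"
  by code_simp

text \<open>Both private neighbours 6 and 7 are forced onto all of 2, 3, 4, 5, which makes room for
  five triangles.\<close>

lemma refute_6_6:
  "refutes 8 [0, 1] [0, 1]
    [(0, 1), (0, 2), (0, 3), (0, 4), (0, 5), (0, 6), (1, 2), (1, 3), (1, 4), (1, 5), (1, 7)]
    [(0, 7), (1, 6)]
    (Split 2 6 (Split 3 6 (Split 4 6 (Split 5 6 (Split 2 7 (Split 3 7 (Split 4 7 (Split 5 7 (Split
    3 4 (Split 3 5 (Reduce [(0,1,2),(0,3,4),(0,5,6),(1,3,5),(1,4,7)] [(0,1),(0,2),(0,6),(1,2),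
    (1,7),(3,4),(3,5),(4,5),(4,7),(5,6)]) (Split 2 3 (Split 2 5 (Split 4 5 (Reduce [(0,1,2),(0,3,4),
    (0,5,6),(1,3,7),(1,4,5)] [(0,1),(0,2),(0,3),(0,4),(1,2),(1,7),(3,4),(3,7),(4,5),(5,6)]) (Matching
    0 5 3 4)) (Matching 0 5 2 3)) (Matching 0 3 2 5))) (Split 2 3 (Split 3 5 (Split 2 4 (Split
    4 5 (Reduce [(0,1,2),(0,3,5),(0,4,6),(1,3,7),(1,4,5)] [(0,1),(0,2),(0,3),(0,5),(1,2),(1,7),
    (3,5),(3,7),(4,5),(4,6)]) (Matching 0 4 3 5)) (Matching 0 4 2 3)) (Matching 0 3 4 5)) (Matching
    0 3 2 4))) (Matching 1 7 0 5)) (Matching 1 7 0 4)) (Matching 1 7 0 3)) (Matching 1 7 0 2))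
    (Matching 0 6 1 5)) (Matching 0 6 1 4)) (Matching 0 6 1 3)) (Matching 0 6 1 2))"
  by code_simp

section \<open>A low vertex beside a vertex of degree 7\<close>

lemma refute_6_7_dominating:
  "refutes 8 [0, 1] [0]
    [(0, 1), (0, 2), (0, 3), (0, 4), (0, 5), (0, 6), (1, 2), (1, 3), (1, 4), (1, 5), (1, 6),
    (1, 7)]
    [(0, 7)]
    (Split 2 4 (Split 4 5 (Split 2 6 (Split 5 6 (Reduce [(0,1,3),(0,2,4),(0,5,6),(1,2,6),(1,4,5)]
    [(0,1),(0,3),(1,3),(1,7),(2,4),(2,5),(2,6),(4,5),(4,6),(5,6)]) (Split 2 5 (Split 3 5 (Split
    3 6 (Split 4 6 (Reduce [(0,1,2),(0,3,5),(0,4,6),(1,3,6),(1,4,5)] [(0,1),(0,2),(0,3),(1,2),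
    (1,3),(1,7),(3,5),(3,6),(4,5),(4,6)]) (Matching 0 6 4 5)) (Matching 0 6 3 5)) (Matching 0
    5 3 6)) (Matching 0 5 2 6))) (Split 2 3 (Split 2 5 (Split 3 6 (Split 4 6 (Split 5 6 (Reduce
    [(0,1,3),(0,2,4),(0,5,6),(1,2,5),(1,4,6)] [(0,1),(0,2),(0,3),(1,3),(1,7),(2,4),(2,5),(4,5),
    (4,6),(5,6)]) (Matching 0 6 2 5)) (Matching 0 6 2 4)) (Matching 0 6 2 3)) (Matching 0 2 5
    6)) (Matching 0 2 3 6))) (Split 4 6 (Split 3 4 (Split 2 5 (Split 3 5 (Split 5 6 (Reduce [(0,1,2),
    (0,3,4),(0,5,6),(1,3,5),(1,4,6)] [(0,1),(0,2),(0,3),(1,2),(1,3),(1,7),(3,4),(3,5),(4,6),(5,6)])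
    (Matching 0 5 4 6)) (Matching 0 5 3 4)) (Matching 0 5 2 4)) (Matching 0 4 3 5)) (Split 5
    6 (Reduce [(0,1,3),(0,2,4),(0,5,6)] [(0,1),(0,2),(0,3),(1,3),(2,4),(5,6)]) (Matching 0 4
    5 6)))) (Split 2 5 (Split 2 3 (Split 2 6 (Split 3 4 (Split 4 5 (Split 4 6 (Reduce [(0,1,3),
    (0,2,5),(0,4,6),(1,2,6),(1,4,5)] [(0,1),(0,2),(0,3),(1,3),(1,7),(2,5),(2,6),(4,5),(4,6),(5,6)])
    (Matching 0 4 2 6)) (Matching 0 4 2 5)) (Matching 0 4 2 3)) (Matching 0 2 4 6)) (Matching
    0 2 3 4)) (Split 2 6 (Matching 0 2 4 5) (Split 2 7 (Matching 0 2 4 5) (Reduce [(0,1,2)] [(0,1),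
    (2,3)])))))"
  by code_simp

text \<open>Since 2 and 3 miss each other and 6 misses 1, the link of 0 is determined except for 45.
  The only splits that are not forced ask whether 2 sees 7 or 8.\<close>

lemma refute_6_7_nonclique:
  "refutes 9 [0, 1] [0]
    [(0, 1), (0, 2), (0, 3), (0, 4), (0, 5), (0, 6), (1, 2), (1, 3), (1, 4), (1, 5), (1, 7),
    (1, 8)]
    [(0, 7), (0, 8), (1, 6), (2, 3)]
    (Split 2 4 (Split 2 5 (Split 2 6 (Split 3 4 (Split 3 5 (Split 3 6 (Split 4 6 (Split 5 6 (Split
    2 7 (Reduce [(0,1,4),(0,2,5),(0,3,6),(1,2,7),(1,3,5)] [(0,1),(0,4),(0,6),(1,4),(1,7),(1,8),
    (2,5),(2,7),(3,5),(3,6)]) (Split 2 8 (Reduce [(0,1,4),(0,2,5),(0,3,6),(1,2,8),(1,3,5)] [(0,1),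
    (0,4),(0,6),(1,4),(1,7),(1,8),(2,5),(2,8),(3,5),(3,6)]) (Reduce [(0,1,3),(0,2,4),(0,5,6),
    (1,2,5)] [(0,2),(0,3),(0,4),(1,3),(1,5),(2,4),(2,5),(5,6)]))) (Matching 0 6 1 5)) (Matching
    0 6 1 4)) (Matching 0 3 2 6)) (Matching 0 3 2 5)) (Matching 0 3 2 4)) (Matching 0 2 3 6))
    (Matching 0 2 3 5)) (Matching 0 2 3 4))"
  by code_simp

text \<open>The missing edge 23 forces the 4-cycle 2 4 3 5. One of its perfect matchings joined to 0
  and the other joined to 1 give four triangles; the deletions are 01, 16, 17 and the five pairs
  left among 2, 3, 4, 5.\<close>

lemma refute_5_7_dominating_nonclique:
  "refutes 8 [0, 1] [0]
    [(0, 1), (0, 2), (0, 3), (0, 4), (0, 5), (1, 2), (1, 3), (1, 4), (1, 5), (1, 6), (1, 7)]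
    [(0, 6), (0, 7), (2, 3)]
    (Split 2 4 (Split 2 5 (Split 3 4 (Split 3 5 (Reduce [(0,2,4),(0,3,5),(1,2,5),(1,3,4)] [(0,1),
    (1,6),(1,7),(2,4),(2,5),(3,4),(3,5),(4,5)]) (Matching 0 3 2 5)) (Matching 0 3 2 4)) (Matching
    0 2 3 5)) (Matching 0 2 3 4))"
  by code_simp

lemma refute_5_7_dominating_nonjoin:
  "refutes 8 [0, 1] [0]
    [(0, 1), (0, 2), (0, 3), (0, 4), (0, 5), (1, 2), (1, 3), (1, 4), (1, 5), (1, 6), (1, 7)]
    [(0, 6), (0, 7), (2, 6)]
    (Split 2 4 (Split 2 5 (Split 2 3 (Split 4 5 (Split 3 4 (Split 3 5 (Split 6 7 (Reduce [(0,2,3),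
    (0,4,5),(1,2,4),(1,3,5),(1,6,7)] [(0,1),(1,6),(1,7),(2,3),(2,4),(2,5),(3,4),(3,5),(4,5),(6,7)])
    (Split 2 7 (Reduce [(0,1,3),(0,2,4),(1,2,7),(1,4,5)] [(0,2),(0,3),(1,3),(1,4),(1,5),(2,4),
    (2,7),(4,5)]) (Split 4 6 (Reduce [(0,1,2),(0,3,4),(1,3,5),(1,4,6)] [(0,2),(0,4),(1,3),(1,4),
    (1,5),(3,4),(3,5),(4,6)]) (Split 4 7 (Reduce [(0,1,2),(0,3,4),(1,3,5),(1,4,7)] [(0,2),(0,4),
    (1,2),(1,3),(1,5),(3,4),(3,5),(4,7)]) (Reduce [(0,1,3),(0,2,5),(1,2,4)] [(0,1),(0,3),(1,3),
    (2,4),(2,5),(4,5)]))))) (Reduce [(0,2,3),(0,4,5),(1,2,5),(1,3,4)] [(0,1),(1,6),(1,7),(2,3),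
    (2,4),(2,5),(3,4),(4,5)])) (Split 3 5 (Reduce [(0,2,3),(0,4,5),(1,2,4),(1,3,5)] [(0,1),(1,6),
    (1,7),(2,3),(2,4),(2,5),(3,5),(4,5)]) (Reduce [(0,1,2),(0,4,5)] [(0,1),(0,2),(1,2),(4,5)])))
    (Split 5 6 (Split 3 4 (Split 3 5 (Reduce [(0,1,2),(0,3,5),(1,3,4),(1,5,6)] [(0,1),(0,2),(1,2),
    (1,6),(1,7),(3,4),(3,5),(5,6)]) (Matching 0 5 3 4)) (Matching 0 4 3 5)) (Reduce [(0,1,3),
    (0,2,4),(1,2,5)] [(0,1),(0,3),(1,3),(1,7),(2,4),(2,5)]))) (Split 3 4 (Split 3 5 (Reduce [(0,2,4),
    (0,3,5),(1,2,5),(1,3,4)] [(0,1),(1,6),(1,7),(2,4),(2,5),(3,4),(3,5),(4,5)]) (Matching 0 3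
    2 5)) (Reduce [(0,1,3),(0,2,4)] [(0,1),(0,5),(1,3),(2,4)]))) (Split 4 5 (Split 2 3 (Split
    3 5 (Reduce [(0,2,3),(0,4,5),(1,2,4),(1,3,5)] [(0,1),(1,6),(1,7),(2,3),(2,4),(3,4),(3,5),
    (4,5)]) (Matching 0 5 2 3)) (Matching 0 2 3 5)) (Reduce [(0,1,3),(0,2,4)] [(0,1),(0,3),(1,3),
    (2,4)]))) (Split 2 5 (Split 2 3 (Split 3 4 (Split 4 5 (Reduce [(0,2,3),(0,4,5),(1,2,5),(1,3,4)]
    [(0,1),(1,6),(1,7),(2,3),(2,5),(3,4),(3,5),(4,5)]) (Matching 0 4 2 5)) (Matching 0 4 2 3))
    (Matching 0 2 3 4)) (Split 2 7 (Matching 0 2 4 5) (Reduce [(0,1,2)] [(0,1),(2,3)]))))"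
  by code_simp

text \<open>The edge 67 supplies a fifth triangle 167. When 2, 3, 4, 5 form a clique, two disjoint
  perfect matchings of it, joined to 0 and to 1, supply the other four.\<close>

lemma refute_5_7_dominating_outer_edge:
  "refutes 8 [0, 1] [0]
    [(0, 1), (0, 2), (0, 3), (0, 4), (0, 5), (1, 2), (1, 3), (1, 4), (1, 5), (1, 6), (1, 7),
    (6, 7)]
    [(0, 6), (0, 7)]
    (Split 2 3 (Split 2 5 (Split 3 5 (Split 3 4 (Split 4 5 (Reduce [(0,2,3),(0,4,5),(1,2,5),(1,3,4),
    (1,6,7)] [(0,1),(1,6),(1,7),(2,3),(2,4),(2,5),(3,4),(3,5),(4,5),(6,7)]) (Reduce [(0,1,2),
    (0,3,4),(1,3,5),(1,6,7)] [(0,1),(0,2),(1,2),(1,6),(1,7),(3,4),(3,5),(6,7)])) (Split 2 4 (Split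
    4 5 (Reduce [(0,1,2),(0,3,5),(1,4,5),(1,6,7)] [(0,1),(0,2),(1,2),(1,6),(1,7),(3,5),(4,5),
    (6,7)]) (Matching 0 4 3 5)) (Matching 0 4 2 3))) (Reduce [(0,1,4),(0,2,3),(1,2,5),(1,6,7)]
    [(0,1),(0,4),(1,4),(1,6),(1,7),(2,3),(2,5),(6,7)])) (Split 3 5 (Split 2 4 (Split 4 5 (Reduce
    [(0,1,3),(0,2,4),(1,4,5),(1,6,7)] [(0,1),(0,3),(1,3),(1,6),(1,7),(2,4),(4,5),(6,7)]) (Matching
    0 5 2 4)) (Matching 0 2 4 5)) (Reduce [(0,1,4),(0,2,3)] [(0,1),(0,4),(1,4),(2,3)]))) (Split
    2 4 (Split 2 5 (Split 3 4 (Split 3 5 (Reduce [(0,1,4),(0,2,5),(1,3,5),(1,6,7)] [(0,1),(0,4),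
    (1,4),(1,6),(1,7),(2,5),(3,5),(6,7)]) (Matching 0 3 2 5)) (Matching 0 3 2 4)) (Matching 0
    2 3 5)) (Split 2 5 (Matching 0 2 3 4) (Reduce [(0,1,2)] [(0,1),(1,2)]))))"
  by code_simp

text \<open>The missing edges 23 and 15 determine the rest of the link of 0, so all later splits are
  about pairs that contain an outer neighbour 6, 7 or 8 of 1.\<close>

lemma refute_5_7_nonclique:
  "refutes 9 [0, 1] [0]
    [(0, 1), (0, 2), (0, 3), (0, 4), (0, 5), (1, 2), (1, 3), (1, 4), (1, 6), (1, 7), (1, 8)]
    [(0, 6), (0, 7), (0, 8), (1, 5), (2, 3)]
    (Split 2 4 (Split 2 5 (Split 3 4 (Split 3 5 (Split 4 5 (Split 2 6 (Split 7 8 (Reduce [(0,2,4),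
    (0,3,5),(1,2,6),(1,3,4),(1,7,8)] [(0,1),(0,5),(1,6),(1,7),(1,8),(2,4),(2,6),(3,4),(3,5),(7,8)])
    (Split 6 7 (Split 6 8 (Split 2 7 (Reduce [(0,2,4),(0,3,5),(1,2,7),(1,3,4),(1,6,8)] [(0,1),
    (0,5),(1,6),(1,7),(1,8),(2,4),(2,7),(3,4),(3,5),(6,8)]) (Split 2 8 (Reduce [(0,1,3),(0,4,5),
    (1,2,8),(1,6,7)] [(0,2),(0,3),(1,3),(1,4),(1,6),(2,8),(4,5),(6,7)]) (Reduce [(0,1,2),(0,3,5),
    (1,3,4),(1,6,7)] [(0,2),(0,4),(1,3),(1,4),(1,6),(3,4),(3,5),(6,7)]))) (Reduce [(0,1,2),(0,3,5),
    (1,3,4),(1,6,7)] [(0,2),(0,4),(1,2),(1,3),(1,4),(3,4),(3,5),(6,7)])) (Split 6 8 (Reduce [(0,1,2),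
    (0,3,5),(1,3,4),(1,6,8)] [(0,2),(0,4),(1,2),(1,3),(1,4),(3,4),(3,5),(6,8)]) (Reduce [(0,2,4),
    (0,3,5),(1,2,6),(1,3,4)] [(0,5),(1,2),(1,3),(1,4),(2,4),(2,6),(3,4),(3,5)])))) (Split 2 7
    (Split 6 8 (Reduce [(0,2,4),(0,3,5),(1,2,7),(1,3,4),(1,6,8)] [(0,1),(0,5),(1,6),(1,7),(1,8),
    (2,4),(2,7),(3,4),(3,5),(6,8)]) (Split 6 7 (Split 7 8 (Split 2 8 (Reduce [(0,1,3),(0,4,5),
    (1,2,8),(1,6,7)] [(0,2),(0,3),(1,3),(1,4),(1,7),(2,8),(4,5),(6,7)]) (Reduce [(0,1,2),(0,3,5),
    (1,3,4),(1,6,7)] [(0,2),(0,4),(1,3),(1,4),(1,7),(3,4),(3,5),(6,7)])) (Reduce [(0,1,2),(0,3,5),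
    (1,3,4),(1,6,7)] [(0,2),(0,4),(1,2),(1,3),(1,4),(3,4),(3,5),(6,7)])) (Split 7 8 (Reduce [(0,1,2),
    (0,3,5),(1,3,4),(1,7,8)] [(0,2),(0,4),(1,2),(1,3),(1,4),(3,4),(3,5),(7,8)]) (Reduce [(0,2,4),
    (0,3,5),(1,2,7),(1,3,4)] [(0,5),(1,2),(1,3),(1,4),(2,4),(2,7),(3,4),(3,5)])))) (Split 2 8
    (Split 6 7 (Reduce [(0,1,2),(0,3,5),(1,3,4),(1,6,7)] [(0,2),(0,4),(1,3),(1,4),(1,8),(3,4),
    (3,5),(6,7)]) (Split 6 8 (Reduce [(0,1,2),(0,3,5),(1,3,4),(1,6,8)] [(0,2),(0,4),(1,3),(1,4),
    (1,8),(3,4),(3,5),(6,8)]) (Split 7 8 (Reduce [(0,1,2),(0,3,5),(1,3,4),(1,7,8)] [(0,2),(0,4),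
    (1,2),(1,3),(1,4),(3,4),(3,5),(7,8)]) (Reduce [(0,1,3),(0,4,5),(1,2,8)] [(0,2),(0,3),(1,3),
    (1,4),(2,8),(4,5)])))) (Reduce [(0,1,2),(0,3,4)] [(0,1),(0,5),(2,4),(3,4)])))) (Matching
    0 5 1 4)) (Matching 0 3 2 5)) (Matching 0 3 2 4)) (Matching 0 2 3 5)) (Matching 0 2 3 4))"
  by code_simp

lemma refute_5_7_nonjoin:
  "refutes 9 [0, 1] [0]
    [(0, 1), (0, 2), (0, 3), (0, 4), (0, 5), (1, 2), (1, 3), (1, 4), (1, 6), (1, 7), (1, 8)]
    [(0, 6), (0, 7), (0, 8), (1, 5), (2, 6)]
    (Split 2 5 (Split 3 5 (Split 4 5 (Split 2 3 (Split 2 4 (Split 2 7 (Split 2 8 (Split 4 6 (Split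
    6 7 (Split 6 8 (Split 7 8 (Reduce [(0,2,4),(0,3,5),(1,2,3),(1,4,6),(1,7,8)] [(0,2),(0,4),
    (1,3),(1,7),(1,8),(2,3),(2,4),(3,5),(4,6),(7,8)]) (Split 3 8 (Reduce [(0,2,4),(0,3,5),(1,2,7),
    (1,3,8),(1,4,6)] [(0,2),(0,4),(1,3),(1,7),(1,8),(2,4),(2,7),(3,5),(3,8),(4,6)]) (Split 3
    7 (Reduce [(0,1,2),(0,4,5),(1,3,7),(1,4,6)] [(0,2),(0,3),(1,2),(1,4),(1,6),(3,7),(4,5),(4,6)])
    (Reduce [(0,1,3),(0,2,4),(1,2,7),(1,4,6)] [(0,3),(0,5),(1,2),(1,4),(1,6),(2,4),(2,7),(4,6)]))))
    (Reduce [(0,1,3),(0,4,5),(1,2,8),(1,4,6)] [(0,2),(0,3),(1,3),(1,4),(1,7),(2,8),(4,5),(4,6)]))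
    (Reduce [(0,1,3),(0,4,5),(1,2,7),(1,4,6)] [(0,2),(0,3),(1,3),(1,4),(1,8),(2,7),(4,5),(4,6)]))
    (Split 4 7 (Split 6 7 (Split 6 8 (Reduce [(0,2,4),(0,3,5),(1,2,3),(1,4,7),(1,6,8)] [(0,2),
    (0,4),(1,3),(1,7),(1,8),(2,3),(2,4),(3,5),(4,7),(6,8)]) (Reduce [(0,1,3),(0,4,5),(1,2,8),
    (1,4,7)] [(0,2),(0,3),(1,3),(1,4),(1,7),(2,8),(4,5),(4,7)])) (Reduce [(0,1,3),(0,2,5),(1,2,8),
    (1,4,7)] [(0,3),(0,4),(1,2),(1,3),(1,8),(2,5),(2,8),(4,7)])) (Split 4 8 (Split 6 7 (Reduce
    [(0,1,2),(0,3,5),(1,4,8),(1,6,7)] [(0,2),(0,4),(1,2),(1,3),(1,8),(3,5),(4,8),(6,7)]) (Reduce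
    [(0,1,3),(0,2,4),(1,2,7),(1,4,8)] [(0,1),(0,3),(0,5),(1,3),(1,8),(2,4),(2,7),(4,8)])) (Reduce
    [(0,1,3),(0,2,5),(1,2,4)] [(0,3),(0,4),(1,2),(1,3),(2,4),(2,5)])))) (Split 6 8 (Reduce [(0,1,3),
    (0,4,5),(1,2,4),(1,6,8)] [(0,2),(0,3),(1,3),(1,4),(1,7),(2,4),(4,5),(6,8)]) (Split 6 7 (Reduce
    [(0,1,3),(0,4,5),(1,2,4),(1,6,7)] [(0,2),(0,3),(1,3),(1,4),(1,7),(2,4),(4,5),(6,7)]) (Split
    7 8 (Reduce [(0,1,3),(0,2,5),(1,2,4),(1,7,8)] [(0,3),(0,4),(1,2),(1,3),(1,4),(2,4),(2,5),
    (7,8)]) (Reduce [(0,1,3),(0,4,5),(1,2,7)] [(0,2),(0,3),(1,3),(1,4),(2,7),(4,5)]))))) (Split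
    2 8 (Split 6 7 (Reduce [(0,1,3),(0,4,5),(1,2,4),(1,6,7)] [(0,2),(0,3),(1,3),(1,4),(1,8),(2,4),
    (4,5),(6,7)]) (Split 6 8 (Reduce [(0,1,3),(0,4,5),(1,2,4),(1,6,8)] [(0,2),(0,3),(1,3),(1,4),
    (1,8),(2,4),(4,5),(6,8)]) (Split 7 8 (Reduce [(0,1,3),(0,2,5),(1,2,4),(1,7,8)] [(0,3),(0,4),
    (1,2),(1,3),(1,4),(2,4),(2,5),(7,8)]) (Reduce [(0,1,3),(0,4,5),(1,2,8)] [(0,2),(0,3),(1,3),
    (1,4),(2,8),(4,5)])))) (Reduce [(0,1,3),(0,4,5),(1,2,4)] [(0,2),(0,3),(1,3),(1,4),(2,4),(4,5)])))
    (Split 3 4 (Split 2 7 (Split 6 8 (Reduce [(0,2,3),(0,4,5),(1,2,7),(1,3,4),(1,6,8)] [(0,1),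
    (0,5),(1,6),(1,7),(1,8),(2,3),(2,7),(3,4),(4,5),(6,8)]) (Split 6 7 (Split 7 8 (Split 4 6
    (Reduce [(0,1,2),(0,3,5),(1,4,6),(1,7,8)] [(0,2),(0,4),(1,3),(1,7),(1,8),(3,5),(4,6),(7,8)])
    (Reduce [(0,1,2),(0,3,5),(1,3,4),(1,6,7)] [(0,2),(0,4),(1,3),(1,7),(1,8),(3,4),(3,5),(6,7)]))
    (Reduce [(0,1,2),(0,3,5),(1,3,4),(1,6,7)] [(0,2),(0,4),(1,2),(1,3),(1,4),(3,4),(3,5),(6,7)]))
    (Split 7 8 (Reduce [(0,1,2),(0,3,5),(1,3,4),(1,7,8)] [(0,2),(0,4),(1,2),(1,3),(1,4),(3,4),
    (3,5),(7,8)]) (Reduce [(0,2,3),(0,4,5),(1,2,7),(1,3,4)] [(0,5),(1,2),(1,3),(1,4),(2,3),(2,7),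
    (3,4),(4,5)])))) (Split 2 8 (Split 6 7 (Reduce [(0,1,2),(0,3,5),(1,3,4),(1,6,7)] [(0,2),(0,4),
    (1,3),(1,4),(1,8),(3,4),(3,5),(6,7)]) (Split 6 8 (Reduce [(0,1,2),(0,3,5),(1,3,4),(1,6,8)]
    [(0,2),(0,4),(1,3),(1,4),(1,8),(3,4),(3,5),(6,8)]) (Split 7 8 (Reduce [(0,1,2),(0,3,5),(1,3,4),
    (1,7,8)] [(0,2),(0,4),(1,2),(1,3),(1,4),(3,4),(3,5),(7,8)]) (Reduce [(0,1,3),(0,4,5),(1,2,8)]
    [(0,2),(0,3),(1,3),(1,4),(2,8),(4,5)])))) (Reduce [(0,1,2),(0,3,4)] [(0,1),(0,5),(2,3),(3,4)])))
    (Reduce [(0,1,4),(0,2,3)] [(0,1),(0,5),(1,4),(2,3)]))) (Split 2 4 (Split 3 4 (Split 2 7 (Split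
    6 8 (Reduce [(0,2,4),(0,3,5),(1,2,7),(1,3,4),(1,6,8)] [(0,1),(0,5),(1,6),(1,7),(1,8),(2,4),
    (2,7),(3,4),(3,5),(6,8)]) (Split 6 7 (Split 7 8 (Split 2 8 (Reduce [(0,1,3),(0,4,5),(1,2,8),
    (1,6,7)] [(0,2),(0,3),(1,3),(1,4),(1,7),(2,8),(4,5),(6,7)]) (Reduce [(0,1,2),(0,3,5),(1,3,4),
    (1,6,7)] [(0,2),(0,4),(1,3),(1,4),(1,7),(3,4),(3,5),(6,7)])) (Reduce [(0,1,2),(0,3,5),(1,3,4),
    (1,6,7)] [(0,2),(0,4),(1,2),(1,3),(1,4),(3,4),(3,5),(6,7)])) (Split 7 8 (Reduce [(0,1,2),
    (0,3,5),(1,3,4),(1,7,8)] [(0,2),(0,4),(1,2),(1,3),(1,4),(3,4),(3,5),(7,8)]) (Reduce [(0,2,4),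
    (0,3,5),(1,2,7),(1,3,4)] [(0,5),(1,2),(1,3),(1,4),(2,4),(2,7),(3,4),(3,5)])))) (Split 2 8
    (Split 6 7 (Reduce [(0,1,2),(0,3,5),(1,3,4),(1,6,7)] [(0,2),(0,4),(1,3),(1,4),(1,8),(3,4),
    (3,5),(6,7)]) (Split 6 8 (Reduce [(0,1,2),(0,3,5),(1,3,4),(1,6,8)] [(0,2),(0,4),(1,3),(1,4),
    (1,8),(3,4),(3,5),(6,8)]) (Split 7 8 (Reduce [(0,1,2),(0,3,5),(1,3,4),(1,7,8)] [(0,2),(0,4),
    (1,2),(1,3),(1,4),(3,4),(3,5),(7,8)]) (Reduce [(0,1,3),(0,4,5),(1,2,8)] [(0,2),(0,3),(1,3),
    (1,4),(2,8),(4,5)])))) (Reduce [(0,1,2),(0,3,4)] [(0,1),(0,5),(2,4),(3,4)]))) (Matching 0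
    3 2 4)) (Split 3 4 (Reduce [(0,1,2),(0,3,4)] [(0,1),(0,5),(1,2),(3,4)]) (Matching 0 2 3 4))))
    (Matching 0 5 1 4)) (Matching 0 5 1 3)) (Matching 0 5 1 2))"
  by code_simp

text \<open>Here 0 is the vertex of degree 5, and 1 and 2 are its neighbours of degree 7.\<close>

lemma refute_5_7_7_dominating:
  "refutes 8 [0, 1, 2] [0]
    [(0, 1), (0, 2), (0, 3), (0, 4), (0, 5), (1, 2), (1, 3), (1, 4), (1, 5), (1, 6), (1, 7),
    (2, 3), (2, 4), (2, 5), (2, 6), (2, 7), (3, 4), (3, 5), (3, 6), (3, 7), (4, 5), (4, 6), (4,
    7), (5, 6), (5, 7)]
    [(0, 6), (0, 7), (6, 7)]
    (Reduce [(0,1,2),(0,3,4),(1,3,5),(1,4,6),(2,3,6),(2,4,5)] [(0,1),(0,2),(1,2),(1,3),(1,7),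
    (2,7),(3,4),(3,5),(3,6),(4,5),(4,6),(5,6)])"
  by code_simp

text \<open>The structure beside a vertex of degree 7 settles every pair that matters, so there is
  no split. The other neighbours of 0 are 3, 4, 5; the outer neighbours are 6, 7, 8 for 1 and 6, 7,
  9 for 2.\<close>

lemma refute_5_7_7_overlap_2:
  "refutes 10 [0, 1, 2] [0]
    [(0, 1), (0, 2), (0, 3), (0, 4), (0, 5), (1, 3), (1, 4), (1, 5), (1, 6), (1, 7), (1, 8),
    (2, 3), (2, 4), (2, 5), (2, 6), (2, 7), (2, 9), (3, 4), (3, 5), (3, 6), (3, 7), (3, 8), (3,
    9), (4, 5), (4, 6), (4, 7), (4, 8), (4, 9), (5, 6), (5, 7), (5, 8), (5, 9)]
    [(0, 6), (0, 7), (0, 8), (0, 9), (1, 2), (1, 9), (2, 8)]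
    (Reduce [(0,1,3),(0,4,5),(1,4,6),(1,5,7),(2,3,6),(2,4,7),(2,5,9)] [(0,4),(0,5),(1,3),(1,6),
    (1,8),(2,3),(2,6),(2,9),(3,6),(4,5),(4,6),(4,7),(5,7),(5,9)])"
  by code_simp

lemma refute_5_7_7_overlap_3:
  "refutes 9 [0, 1, 2] [0]
    [(0, 1), (0, 2), (0, 3), (0, 4), (0, 5), (1, 3), (1, 4), (1, 5), (1, 6), (1, 7), (1, 8),
    (2, 3), (2, 4), (2, 5), (2, 6), (2, 7), (2, 8), (3, 4), (3, 5), (3, 6), (3, 7), (3, 8), (4,
    5), (4, 6), (4, 7), (4, 8), (5, 6), (5, 7), (5, 8)]
    [(0, 6), (0, 7), (0, 8), (1, 2)]
    (Reduce [(0,1,3),(0,4,5),(1,4,6),(1,5,7),(2,3,6),(2,4,7),(2,5,8)] [(0,4),(0,5),(1,3),(1,6),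
    (1,8),(2,3),(2,6),(2,8),(3,6),(4,5),(4,6),(4,7),(5,7),(5,8)])"
  by code_simp

text \<open>
  Here 0 is the vertex of degree 8, its low neighbours are 6, 7 and 8, and 9 is a neighbour of 6
  outside the link of 0. The numbers in the names count the neighbours of 6 and 7 in that link and
  their common neighbours.
\<close>

lemma refute_8_three_low_33_3:
  "refutes 10 [0, 6] [6, 7, 8]
    [(0, 1), (0, 2), (0, 3), (0, 4), (0, 5), (0, 6), (0, 7), (0, 8), (1, 6), (1, 7), (2, 6),
    (2, 7), (3, 6), (3, 7), (6, 9)]
    [(0, 9), (4, 6), (4, 7), (5, 6), (5, 7), (6, 7), (6, 8), (7, 8)]
    (Split 1 9 (Split 2 9 (Split 3 9 (Split 1 4 (Split 5 8 (Reduce [(0,1,4),(0,2,6),(0,3,7),(0,5,8)]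
    [(0,1),(0,2),(0,3),(0,4),(1,4),(2,6),(3,7),(5,8)]) (Split 4 5 (Split 3 8 (Reduce [(0,1,6),
    (0,2,7),(0,3,8),(0,4,5)] [(0,1),(0,2),(0,3),(0,4),(1,6),(2,7),(3,8),(4,5)]) (Split 3 5 (Split
    4 8 (Reduce [(0,1,6),(0,2,7),(0,3,5),(0,4,8)] [(0,1),(0,2),(0,3),(0,4),(1,6),(2,7),(3,5),
    (4,8)]) (Reduce [(0,1,6),(0,2,7),(0,4,5)] [(0,1),(0,2),(0,3),(1,6),(2,7),(4,5)])) (Reduce
    [(0,1,4),(0,2,6),(0,3,7),(1,6,9)] [(0,1),(0,2),(0,4),(1,4),(1,9),(2,6),(3,6),(3,7)]))) (Split
    4 8 (Reduce [(0,1,6),(0,2,7),(0,4,8)] [(0,1),(0,2),(0,3),(1,6),(2,7),(4,8)]) (Reduce [(0,1,4),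
    (0,2,6),(0,3,7)] [(0,1),(0,2),(0,3),(1,4),(2,6),(3,7)])))) (Split 1 5 (Split 4 8 (Reduce
    [(0,1,5),(0,2,6),(0,3,7),(0,4,8)] [(0,1),(0,2),(0,3),(0,5),(1,5),(2,6),(3,7),(4,8)]) (Split
    4 5 (Split 3 8 (Reduce [(0,1,6),(0,2,7),(0,3,8),(0,4,5)] [(0,1),(0,2),(0,3),(0,5),(1,6),(2,7),
    (3,8),(4,5)]) (Split 3 4 (Split 5 8 (Reduce [(0,1,6),(0,2,7),(0,3,4),(0,5,8)] [(0,1),(0,2),
    (0,3),(0,4),(1,6),(2,7),(3,4),(5,8)]) (Reduce [(0,1,6),(0,2,7),(0,4,5)] [(0,1),(0,2),(0,3),
    (1,6),(2,7),(4,5)])) (Reduce [(0,1,5),(0,2,6),(0,3,7),(1,6,9)] [(0,1),(0,2),(0,5),(1,5),(1,9),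
    (2,6),(3,6),(3,7)]))) (Split 5 8 (Reduce [(0,1,6),(0,2,7),(0,5,8)] [(0,1),(0,2),(0,3),(1,6),
    (2,7),(5,8)]) (Reduce [(0,1,5),(0,2,6),(0,3,7)] [(0,1),(0,2),(0,3),(1,5),(2,6),(3,7)]))))
    (Split 3 8 (Reduce [(0,1,7),(0,2,6),(0,3,8),(3,6,9)] [(0,2),(0,3),(0,8),(1,6),(1,7),(2,6),
    (3,8),(3,9)]) (Split 4 5 (Reduce [(0,1,7),(0,2,6),(0,4,5),(3,6,9)] [(0,2),(0,3),(0,8),(1,6),
    (1,7),(2,6),(3,9),(4,5)]) (Split 2 4 (Reduce [(0,1,7),(0,2,4),(0,3,6),(2,6,9)] [(0,2),(0,3),
    (0,8),(1,6),(1,7),(2,4),(2,9),(3,6)]) (Split 2 5 (Reduce [(0,1,7),(0,2,5),(0,3,6),(2,6,9)]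
    [(0,2),(0,3),(0,8),(1,6),(1,7),(2,5),(2,9),(3,6)]) (Split 3 4 (Reduce [(0,1,6),(0,2,7),(0,3,4),
    (3,6,9)] [(0,1),(0,3),(0,8),(1,6),(2,6),(2,7),(3,4),(3,9)]) (Split 3 5 (Reduce [(0,1,6),(0,2,7),
    (0,3,5),(3,6,9)] [(0,1),(0,3),(0,8),(1,6),(2,6),(2,7),(3,5),(3,9)]) (Reduce [(0,1,6),(0,3,7),
    (2,6,9)] [(0,1),(0,2),(1,6),(2,9),(3,6),(3,7)]))))))))) (Matching 6 9 0 3)) (Matching 6 9
    0 2)) (Matching 6 9 0 1))"
  by code_simp

lemma refute_8_three_low_33_2:
  "refutes 10 [0, 6] [6, 7, 8]
    [(0, 1), (0, 2), (0, 3), (0, 4), (0, 5), (0, 6), (0, 7), (0, 8), (1, 6), (1, 7), (2, 6),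
    (2, 7), (3, 6), (4, 7), (6, 9)]
    [(0, 9), (3, 7), (4, 6), (5, 6), (5, 7), (6, 7), (6, 8), (7, 8)]
    (Split 1 9 (Split 2 9 (Split 3 9 (Split 1 2 (Split 5 8 (Reduce [(0,1,2),(0,3,6),(0,4,7),(0,5,8)]
    [(0,1),(0,2),(0,3),(0,4),(1,2),(3,6),(4,7),(5,8)]) (Split 4 5 (Split 3 8 (Reduce [(0,1,6),
    (0,2,7),(0,3,8),(0,4,5)] [(0,1),(0,2),(0,3),(0,4),(1,6),(2,7),(3,8),(4,5)]) (Split 3 5 (Reduce
    [(0,1,6),(0,2,7),(0,3,5),(2,6,9)] [(0,1),(0,2),(0,4),(1,6),(2,7),(2,9),(3,5),(3,6)]) (Reduce
    [(0,1,2),(0,3,6),(0,4,5)] [(0,1),(0,2),(0,4),(1,2),(3,6),(4,5)]))) (Split 4 8 (Split 1 5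
    (Reduce [(0,1,5),(0,2,7),(0,3,6),(0,4,8)] [(0,1),(0,2),(0,3),(0,4),(1,5),(2,7),(3,6),(4,8)])
    (Split 3 5 (Reduce [(0,1,6),(0,2,7),(0,3,5),(0,4,8)] [(0,1),(0,2),(0,3),(0,4),(1,6),(2,7),
    (3,5),(4,8)]) (Split 3 8 (Reduce [(0,1,6),(0,2,7),(0,3,8),(2,6,9)] [(0,1),(0,2),(0,4),(1,6),
    (2,7),(2,9),(3,6),(3,8)]) (Reduce [(0,1,2),(0,3,6),(0,4,7)] [(0,1),(0,2),(0,4),(1,2),(3,6),
    (4,7)])))) (Reduce [(0,1,2),(0,3,6),(0,4,7)] [(0,1),(0,2),(0,3),(1,2),(3,6),(4,7)])))) (Split
    1 3 (Split 2 3 (Split 1 4 (Split 2 4 (Split 5 8 (Reduce [(0,1,3),(0,2,4),(0,5,8),(1,6,9),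
    (2,3,6)] [(0,1),(0,2),(0,3),(0,4),(1,3),(1,9),(2,3),(2,4),(5,8),(6,9)]) (Split 2 5 (Reduce
    [(0,1,3),(0,2,5),(0,4,7),(1,6,9),(2,3,6)] [(0,1),(0,2),(0,3),(0,4),(1,3),(1,9),(2,3),(2,5),
    (4,7),(6,9)]) (Split 4 5 (Reduce [(0,1,3),(0,2,7),(0,4,5),(1,6,9),(2,3,6)] [(0,1),(0,2),(0,3),
    (0,4),(1,3),(1,9),(2,3),(2,7),(4,5),(6,9)]) (Split 4 8 (Reduce [(0,1,3),(0,2,7),(0,4,8),(1,6,9),
    (2,3,6)] [(0,1),(0,2),(0,3),(0,4),(1,3),(1,9),(2,3),(2,7),(4,8),(6,9)]) (Reduce [(0,1,3),
    (0,2,6),(0,4,7)] [(0,1),(0,2),(0,3),(1,3),(2,6),(4,7)]))))) (Matching 7 2 1 4)) (Matching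
    7 1 2 4)) (Matching 6 2 1 3)) (Matching 6 1 2 3))) (Matching 6 9 0 3)) (Matching 6 9 0 2))
    (Matching 6 9 0 1))"
  by code_simp

lemma refute_8_three_low_33_1:
  "refutes 10 [0, 6] [6, 7, 8]
    [(0, 1), (0, 2), (0, 3), (0, 4), (0, 5), (0, 6), (0, 7), (0, 8), (1, 6), (1, 7), (2, 6),
    (3, 6), (4, 7), (5, 7), (6, 9)]
    [(0, 9), (2, 7), (3, 7), (4, 6), (5, 6), (6, 7), (6, 8), (7, 8)]
    (Split 1 9 (Split 2 9 (Split 3 9 (Split 1 4 (Split 3 8 (Reduce [(0,1,4),(0,2,6),(0,3,8),(0,5,7),
    (1,6,9)] [(0,1),(0,2),(0,4),(0,5),(1,4),(1,9),(2,6),(3,6),(3,8),(5,7)]) (Split 2 8 (Reduce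
    [(0,1,4),(0,2,8),(0,3,6),(0,5,7)] [(0,1),(0,2),(0,4),(0,5),(1,4),(2,8),(3,6),(5,7)]) (Split
    2 3 (Split 5 8 (Reduce [(0,1,6),(0,2,3),(0,4,7),(0,5,8)] [(0,1),(0,4),(0,5),(0,6),(1,6),(2,3),
    (4,7),(5,8)]) (Split 2 5 (Split 1 3 (Reduce [(0,1,3),(0,2,5),(0,4,7),(1,6,9),(2,3,6)] [(0,1),
    (0,4),(0,5),(1,3),(1,9),(2,3),(2,5),(2,6),(3,6),(4,7)]) (Split 1 2 (Reduce [(0,1,4),(0,2,3),
    (0,5,7),(1,2,6),(3,6,9)] [(0,1),(0,2),(0,3),(0,4),(1,2),(1,4),(2,3),(3,9),(5,7),(6,9)]) (Matching
    6 1 2 3))) (Reduce [(0,1,4),(0,2,6),(0,5,7)] [(0,1),(0,3),(0,4),(1,4),(2,6),(5,7)]))) (Reduce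
    [(0,1,4),(0,2,6),(0,5,7),(1,6,9)] [(0,1),(0,4),(0,5),(1,4),(1,9),(2,6),(3,6),(5,7)])))) (Split
    1 5 (Split 4 5 (Split 3 8 (Reduce [(0,1,5),(0,2,6),(0,3,8),(0,4,7),(1,6,9)] [(0,1),(0,2),
    (0,4),(0,5),(1,5),(1,9),(2,6),(3,6),(3,8),(4,7)]) (Split 2 8 (Reduce [(0,1,5),(0,2,8),(0,3,6),
    (0,4,7)] [(0,1),(0,2),(0,4),(0,5),(1,5),(2,8),(3,6),(4,7)]) (Split 2 3 (Split 5 8 (Reduce
    [(0,1,6),(0,2,3),(0,4,7),(0,5,8)] [(0,1),(0,4),(0,5),(0,6),(1,6),(2,3),(4,7),(5,8)]) (Split
    4 8 (Reduce [(0,1,6),(0,2,3),(0,4,8),(0,5,7)] [(0,1),(0,2),(0,3),(0,4),(1,6),(2,3),(4,8),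
    (5,7)]) (Split 2 4 (Split 1 3 (Reduce [(0,1,3),(0,2,4),(0,5,7),(1,6,9),(2,3,6)] [(0,1),(0,4),
    (0,5),(1,3),(1,9),(2,3),(2,4),(2,6),(3,6),(5,7)]) (Split 1 2 (Reduce [(0,1,5),(0,2,3),(0,4,7),
    (1,2,6),(3,6,9)] [(0,1),(0,2),(0,3),(0,5),(1,2),(1,5),(2,3),(3,9),(4,7),(6,9)]) (Matching
    6 1 2 3))) (Reduce [(0,1,5),(0,2,6),(0,4,7)] [(0,1),(0,3),(0,5),(1,5),(2,6),(4,7)])))) (Reduce
    [(0,1,5),(0,2,6),(0,4,7),(1,6,9)] [(0,1),(0,4),(0,5),(1,5),(1,9),(2,6),(3,6),(4,7)])))) (Matching
    7 4 1 5)) (Matching 7 1 4 5))) (Matching 6 9 0 3)) (Matching 6 9 0 2)) (Matching 6 9 0 1))"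
  by code_simp

lemma refute_8_three_low_34_3:
  "refutes 10 [0, 6] [6, 7, 8]
    [(0, 1), (0, 2), (0, 3), (0, 4), (0, 5), (0, 6), (0, 7), (0, 8), (1, 6), (1, 7), (2, 6),
    (2, 7), (3, 6), (3, 7), (4, 7), (6, 9)]
    [(0, 9), (4, 6), (5, 6), (5, 7), (6, 7), (6, 8), (7, 8)]
    (Split 1 9 (Split 2 9 (Split 3 9 (Split 1 2 (Split 5 8 (Reduce [(0,1,2),(0,3,6),(0,4,7),(0,5,8)]
    [(0,1),(0,2),(0,3),(0,4),(1,2),(3,6),(4,7),(5,8)]) (Split 4 5 (Split 3 8 (Reduce [(0,1,6),
    (0,2,7),(0,3,8),(0,4,5)] [(0,1),(0,2),(0,3),(0,4),(1,6),(2,7),(3,8),(4,5)]) (Split 2 8 (Reduce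
    [(0,1,6),(0,2,8),(0,3,7),(0,4,5)] [(0,1),(0,2),(0,3),(0,4),(1,6),(2,8),(3,7),(4,5)]) (Split
    2 5 (Split 4 8 (Reduce [(0,1,6),(0,2,5),(0,3,7),(0,4,8)] [(0,1),(0,2),(0,3),(0,4),(1,6),(2,5),
    (3,7),(4,8)]) (Split 3 5 (Split 1 8 (Reduce [(0,1,8)] [(0,1),(1,8)]) (Isolated 0 8)) (Reduce
    [(0,1,6),(0,2,5),(0,3,7),(2,6,9)] [(0,1),(0,2),(0,4),(1,6),(2,5),(2,9),(3,6),(3,7)]))) (Reduce
    [(0,1,6),(0,2,7),(0,4,5),(3,6,9)] [(0,1),(0,3),(0,4),(1,6),(2,6),(2,7),(3,9),(4,5)])))) (Split
    4 8 (Split 1 5 (Reduce [(0,1,5),(0,2,6),(0,3,7),(0,4,8)] [(0,1),(0,2),(0,3),(0,4),(1,5),(2,6),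
    (3,7),(4,8)]) (Split 2 5 (Reduce [(0,1,6),(0,2,5),(0,3,7),(0,4,8)] [(0,1),(0,2),(0,3),(0,4),
    (1,6),(2,5),(3,7),(4,8)]) (Split 3 5 (Reduce [(0,1,6),(0,2,7),(0,3,5),(0,4,8)] [(0,1),(0,2),
    (0,3),(0,4),(1,6),(2,7),(3,5),(4,8)]) (Isolated 0 5)))) (Reduce [(0,1,2),(0,3,6),(0,4,7)]
    [(0,1),(0,2),(0,3),(1,2),(3,6),(4,7)])))) (Split 1 3 (Split 2 3 (Split 1 4 (Split 2 4 (Split
    5 8 (Reduce [(0,1,3),(0,2,4),(0,5,8),(1,6,9),(2,3,6)] [(0,1),(0,2),(0,3),(0,4),(1,3),(1,9),
    (2,3),(2,4),(5,8),(6,9)]) (Split 2 5 (Reduce [(0,1,3),(0,2,5),(0,4,7),(1,6,9),(2,3,6)] [(0,1),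
    (0,2),(0,3),(0,4),(1,3),(1,9),(2,3),(2,5),(4,7),(6,9)]) (Split 4 5 (Reduce [(0,1,3),(0,2,7),
    (0,4,5),(1,6,9),(2,3,6)] [(0,1),(0,2),(0,3),(0,4),(1,3),(1,9),(2,3),(2,7),(4,5),(6,9)]) (Split
    4 8 (Reduce [(0,1,3),(0,2,7),(0,4,8),(1,6,9),(2,3,6)] [(0,1),(0,2),(0,3),(0,4),(1,3),(1,9),
    (2,3),(2,7),(4,8),(6,9)]) (Reduce [(0,1,3),(0,2,6),(0,4,7)] [(0,1),(0,2),(0,3),(1,3),(2,6),
    (4,7)]))))) (Matching 7 2 1 4)) (Matching 7 1 2 4)) (Matching 6 2 1 3)) (Matching 6 1 2 3)))
    (Matching 6 9 0 3)) (Matching 6 9 0 2)) (Matching 6 9 0 1))"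
  by code_simp

lemma refute_8_three_low_34_2:
  "refutes 10 [0, 6] [6, 7, 8]
    [(0, 1), (0, 2), (0, 3), (0, 4), (0, 5), (0, 6), (0, 7), (0, 8), (1, 6), (1, 7), (2, 6),
    (2, 7), (3, 6), (4, 7), (5, 7), (6, 9)]
    [(0, 9), (3, 7), (4, 6), (5, 6), (6, 7), (6, 8), (7, 8)]
    (Split 1 9 (Split 2 9 (Split 3 9 (Split 1 4 (Split 3 8 (Reduce [(0,1,4),(0,2,6),(0,3,8),(0,5,7),
    (1,6,9)] [(0,1),(0,2),(0,4),(0,5),(1,4),(1,9),(2,6),(3,6),(3,8),(5,7)]) (Split 5 8 (Reduce
    [(0,1,4),(0,2,7),(0,3,6),(0,5,8)] [(0,1),(0,2),(0,4),(0,5),(1,4),(2,7),(3,6),(5,8)]) (Split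
    3 5 (Split 2 8 (Reduce [(0,1,4),(0,2,8),(0,3,6),(0,5,7)] [(0,1),(0,2),(0,3),(0,4),(1,4),(2,8),
    (3,6),(5,7)]) (Split 2 3 (Reduce [(0,1,4),(0,2,7),(0,3,5),(1,6,9),(2,3,6)] [(0,1),(0,4),(0,5),
    (1,4),(1,9),(2,3),(2,6),(2,7),(3,5),(3,6)]) (Split 1 2 (Split 1 3 (Reduce [(0,1,4),(0,2,7),
    (0,3,6),(1,6,9)] [(0,1),(0,4),(0,5),(1,4),(1,9),(2,6),(2,7),(3,6)]) (Matching 6 3 1 2)) (Matching
    6 2 1 3)))) (Reduce [(0,1,4),(0,2,6),(0,5,7),(1,6,9)] [(0,1),(0,2),(0,4),(1,4),(1,9),(2,6),
    (3,6),(5,7)])))) (Split 1 2 (Split 1 5 (Split 2 4 (Split 4 5 (Split 3 8 (Reduce [(0,1,5),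
    (0,2,6),(0,3,8),(0,4,7),(1,6,9)] [(0,1),(0,2),(0,4),(0,5),(1,5),(1,9),(2,6),(3,6),(3,8),(4,7)])
    (Split 5 8 (Reduce [(0,1,2),(0,3,6),(0,4,7),(0,5,8)] [(0,1),(0,2),(0,4),(0,5),(1,2),(3,6),
    (4,7),(5,8)]) (Split 4 8 (Reduce [(0,1,2),(0,3,6),(0,4,8),(0,5,7)] [(0,1),(0,2),(0,3),(0,4),
    (1,2),(3,6),(4,8),(5,7)]) (Split 3 4 (Split 3 5 (Split 2 8 (Reduce [(0,1,5),(0,2,8),(0,3,6),
    (0,4,7)] [(0,1),(0,2),(0,3),(0,5),(1,5),(2,8),(3,6),(4,7)]) (Split 2 3 (Reduce [(0,1,5),(0,2,7),
    (0,3,4),(1,6,9),(2,3,6)] [(0,1),(0,4),(0,5),(1,5),(1,9),(2,3),(2,6),(2,7),(3,4),(3,6)]) (Split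
    1 3 (Reduce [(0,1,2),(0,3,4),(0,5,7),(1,3,6),(2,6,9)] [(0,1),(0,2),(0,3),(0,4),(1,2),(1,3),
    (2,9),(3,4),(5,7),(6,9)]) (Matching 6 3 1 2)))) (Reduce [(0,1,2),(0,3,6),(0,5,7)] [(0,1),
    (0,2),(0,4),(1,2),(3,6),(5,7)])) (Reduce [(0,1,2),(0,3,6),(0,4,7)] [(0,1),(0,2),(0,5),(1,2),
    (3,6),(4,7)]))))) (Matching 7 4 1 5)) (Matching 7 4 1 2)) (Matching 7 1 4 5)) (Matching 7
    1 2 4))) (Matching 6 9 0 3)) (Matching 6 9 0 2)) (Matching 6 9 0 1))"
  by code_simp

text \<open>All neighbours of 6 now lie in the closed neighbourhood of 0, hence nine indices instead
  of ten.\<close>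

lemma refute_8_three_low_44_4:
  "refutes 9 [0, 6] [6, 7, 8]
    [(0, 1), (0, 2), (0, 3), (0, 4), (0, 5), (0, 6), (0, 7), (0, 8), (1, 6), (1, 7), (2, 6),
    (2, 7), (3, 6), (3, 7), (4, 6), (4, 7)]
    [(5, 6), (5, 7), (6, 7), (6, 8), (7, 8)]
    (Split 1 2 (Split 5 8 (Reduce [(0,1,2),(0,3,6),(0,4,7),(0,5,8)] [(0,1),(0,2),(0,3),(0,4),
    (1,2),(3,6),(4,7),(5,8)]) (Split 1 4 (Split 2 4 (Split 1 3 (Split 2 3 (Split 3 4 (Split 4
    5 (Split 3 8 (Reduce [(0,1,6),(0,2,7),(0,3,8),(0,4,5)] [(0,1),(0,2),(0,3),(0,4),(1,6),(2,7),
    (3,8),(4,5)]) (Split 3 5 (Split 4 8 (Reduce [(0,1,6),(0,2,7),(0,3,5),(0,4,8)] [(0,1),(0,2),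
    (0,3),(0,4),(1,6),(2,7),(3,5),(4,8)]) (Split 2 8 (Reduce [(0,1,6),(0,2,8),(0,3,5),(0,4,7)]
    [(0,1),(0,2),(0,3),(0,4),(1,6),(2,8),(3,5),(4,7)]) (Split 2 5 (Split 1 8 (Reduce [(0,1,8)]
    [(0,1),(1,8)]) (Isolated 0 8)) (Reduce [(0,1,2),(0,3,5),(0,4,7),(1,4,6),(2,3,6)] [(0,1),(0,4),
    (0,7),(1,2),(1,4),(2,3),(2,6),(3,5),(3,6),(4,7)])))) (Reduce [(0,1,2),(0,3,7),(0,4,5),(1,3,6),
    (2,4,6)] [(0,1),(0,2),(0,4),(1,2),(1,3),(1,4),(2,4),(3,6),(3,7),(4,5)]))) (Split 4 8 (Split
    1 5 (Reduce [(0,1,5),(0,2,6),(0,3,7),(0,4,8)] [(0,1),(0,2),(0,3),(0,4),(1,5),(2,6),(3,7),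
    (4,8)]) (Split 1 8 (Split 2 5 (Reduce [(0,1,6),(0,2,5),(0,3,7),(0,4,8)] [(0,1),(0,2),(0,3),
    (0,4),(1,6),(2,5),(3,7),(4,8)]) (Split 2 8 (Split 3 5 (Reduce [(0,1,6),(0,2,7),(0,3,5),(0,4,8)]
    [(0,1),(0,2),(0,3),(0,4),(1,6),(2,7),(3,5),(4,8)]) (Isolated 0 5)) (Reduce [(0,1,2),(0,3,7),
    (0,4,8),(1,3,6),(2,4,6)] [(0,1),(0,3),(0,7),(1,2),(1,3),(2,4),(2,6),(3,7),(4,6),(4,8)])))
    (Reduce [(0,1,2),(0,3,7),(0,4,8),(1,4,6),(2,3,6)] [(0,2),(0,3),(0,7),(1,2),(1,4),(1,6),(2,3),
    (3,7),(4,6),(4,8)]))) (Reduce [(0,1,2),(0,3,6),(0,4,7),(1,4,6)] [(0,1),(0,2),(0,3),(1,2),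
    (1,4),(3,6),(4,6),(4,7)]))) (Reduce [(0,1,3),(0,2,6),(0,4,7),(1,4,6)] [(0,1),(0,2),(0,3),
    (0,4),(1,3),(1,4),(2,6),(4,7)])) (Reduce [(0,1,2),(0,3,7),(0,4,6),(1,3,6)] [(0,1),(0,2),(0,3),
    (0,4),(1,2),(1,3),(3,7),(4,6)])) (Split 3 4 (Split 2 3 (Reduce [(0,1,2),(0,3,7),(0,4,6),(2,3,6)]
    [(0,1),(0,2),(0,3),(0,4),(1,2),(2,3),(3,7),(4,6)]) (Matching 6 3 1 2)) (Reduce [(0,1,2),(0,3,6),
    (0,4,7),(1,4,6)] [(0,1),(0,2),(0,3),(0,4),(1,2),(1,4),(2,6),(4,7)]))) (Reduce [(0,1,2),(0,3,6),
    (0,4,7),(1,4,6)] [(0,1),(0,2),(0,3),(0,4),(1,2),(1,4),(3,6),(4,7)])) (Split 1 3 (Split 2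
    4 (Split 3 4 (Reduce [(0,1,2),(0,3,6),(0,4,7),(2,4,6)] [(0,1),(0,2),(0,3),(0,4),(1,2),(2,4),
    (3,6),(4,7)]) (Matching 6 4 1 3)) (Matching 6 4 1 2)) (Matching 6 1 3 4)))) (Split 1 3 (Split
    1 4 (Split 2 3 (Split 2 4 (Reduce [(0,1,3),(0,2,7),(0,4,6),(2,3,6)] [(0,1),(0,2),(0,3),(0,4),
    (1,3),(2,3),(2,7),(4,6)]) (Matching 6 2 1 4)) (Matching 6 2 1 3)) (Matching 6 1 2 4)) (Matching
    6 1 2 3)))"
  by code_simp

lemma refute_8_three_low_44_3:
  "refutes 9 [0, 6] [6, 7, 8]
    [(0, 1), (0, 2), (0, 3), (0, 4), (0, 5), (0, 6), (0, 7), (0, 8), (1, 6), (1, 7), (2, 6),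
    (2, 7), (3, 6), (3, 7), (4, 6), (5, 7)]
    [(4, 7), (5, 6), (6, 7), (6, 8), (7, 8)]
    (Split 1 2 (Split 4 8 (Split 5 8 (Split 1 4 (Reduce [(0,1,2),(0,3,6),(0,4,8),(0,5,7),(1,4,6)]
    [(0,1),(0,2),(0,3),(0,5),(1,2),(1,4),(3,6),(4,6),(4,8),(5,7)]) (Split 1 3 (Split 2 4 (Split
    3 4 (Reduce [(0,1,2),(0,3,4),(0,5,7),(1,3,6),(2,4,6)] [(0,5),(0,6),(0,7),(0,8),(1,2),(1,3),
    (2,3),(2,4),(3,4),(5,7)]) (Matching 6 4 1 3)) (Matching 6 4 1 2)) (Matching 6 1 3 4))) (Reduce
    [(0,1,2),(0,3,6),(0,4,8),(0,5,7)] [(0,1),(0,2),(0,3),(0,4),(1,2),(3,6),(4,8),(5,7)])) (Split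
    5 8 (Reduce [(0,1,2),(0,3,7),(0,4,6),(0,5,8)] [(0,1),(0,2),(0,3),(0,5),(1,2),(3,7),(4,6),
    (5,8)]) (Split 3 8 (Reduce [(0,1,2),(0,3,8),(0,4,6),(0,5,7)] [(0,1),(0,2),(0,3),(0,4),(1,2),
    (3,8),(4,6),(5,7)]) (Split 4 5 (Split 2 8 (Reduce [(0,1,7),(0,2,8),(0,3,6),(0,4,5),(1,2,6)]
    [(0,1),(0,2),(0,3),(0,5),(1,2),(1,7),(2,8),(3,6),(4,5),(4,6)]) (Split 1 8 (Reduce [(0,1,8)]
    [(0,1),(1,8)]) (Isolated 0 8))) (Reduce [(0,1,2),(0,4,6),(0,5,7)] [(0,1),(0,2),(0,3),(1,2),
    (4,6),(5,7)]))))) (Split 1 3 (Split 1 4 (Split 2 3 (Split 2 4 (Split 1 5 (Split 2 5 (Reduce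
    [(0,1,3),(0,2,4),(0,5,7),(1,4,6),(2,3,6)] [(0,5),(0,6),(0,7),(0,8),(1,3),(1,4),(2,3),(2,4),
    (3,4),(5,7)]) (Matching 7 2 1 5)) (Matching 7 1 2 5)) (Matching 6 2 1 4)) (Matching 6 2 1
    3)) (Matching 6 1 2 4)) (Matching 6 1 2 3)))"
  by code_simp

section \<open>Vertices of small degree\<close>

text \<open>Lists a neighbourhood with some distinguished vertices in front, the form in which
  certificates name vertices.\<close>

lemma extend_distinct_list:
  assumes "finite A" "distinct xs" "set xs \<subseteq> A"
  shows "\<exists>ys. distinct (xs @ ys) \<and> set (xs @ ys) = A \<and> length (xs @ ys) = card A"
proof -
  obtain ys where ys: "distinct ys" "set ys = A - set xs"
    using finite_distinct_list[of "A - set xs"] assms(1) by auto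
  then have "distinct (xs @ ys)" "set (xs @ ys) = A" using assms by auto
  then show ?thesis using distinct_card by metis
qed

context irreducible_graph
begin

lemma edge_iff_nbrs: "{a, b} \<in> E \<longleftrightarrow> b \<in> nbrs a"
  by (simp add: nbrs_def)

definition low :: "'a \<Rightarrow> bool" where
  "low v \<longleftrightarrow> deg v = 5 \<or> deg v = 6"

text \<open>The edge \<open>v w\<close> lies in a triangle, so the link of \<open>v\<close> contains
  an edge \<open>w c\<close>. With degree at most 4, at most two neighbours remain, one certificate
  for each number.\<close>

lemma deg_ge_5:
  assumes "w \<in> nbrs v"
  shows "deg v \<ge> 5"
proof (rule ccontr)
  assume "\<not> deg v \<ge> 5"
  obtain c where c: "c \<in> nbrs v" "c \<in> nbrs w"
    using edge_common_nbr assms by (auto simp: edge_iff_nbrs)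
  then have "w \<noteq> c" by auto
  obtain ys where ys: "distinct ([w, c] @ ys)" "set ([w, c] @ ys) = nbrs v" "length ([w, c] @ ys) = deg v"
    using extend_distinct_list[of "nbrs v" "[w, c]"] assms c \<open>w \<noteq> c\<close> by auto
  have "v \<notin> set ([w, c] @ ys)" using ys by auto
  then have d: "distinct (v # w # c # ys)" using ys by auto
  have "length ys \<le> 2" using ys \<open>\<not> deg v \<ge> 5\<close> by auto
  then consider "ys = []" | x where "ys = [x]" | x y where "ys = [x, y]"
    by (cases ys; cases "tl ys") auto
  then show False
  proof cases
    case 1
    show False
      by (rule refutes_sound[OF refute_degree_2, of "[v, w, c]"])
        (use d ys c 1 in \<open>auto simp: edge_iff_nbrs\<close>)
  next
    case 2
    show False
      by (rule refutes_sound[OF refute_degree_3, of "[v, w, c, x]"])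
        (use d ys c 2 in \<open>auto simp: edge_iff_nbrs\<close>)
  next
    case 3
    show False
      by (rule refutes_sound[OF refute_degree_4, of "[v, w, c, x, y]"])
        (use d ys c 3 in \<open>auto simp: edge_iff_nbrs\<close>)
  qed
qed

lemma low_matching_link:
  assumes "low v"
  shows "matching_link v"
proof (rule ccontr)
  assume "\<not> matching_link v"
  then obtain a b c where abc: "a \<in> nbrs v" "b \<in> nbrs v" "c \<in> nbrs v" "distinct [a, b, c]"
    "b \<notin> nbrs a" "c \<notin> nbrs a"
    unfolding matching_link_def edge_iff_nbrs by blast
  obtain ys where ys: "distinct ([a, b, c] @ ys)" "set ([a, b, c] @ ys) = nbrs v"
    "length ([a, b, c] @ ys) = deg v"
    using extend_distinct_list[of "nbrs v" "[a, b, c]"] abc by auto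
  have "v \<notin> set ([a, b, c] @ ys)" using ys by auto
  then have d: "distinct (v # a # b # c # ys)" using ys by auto
  have "length ys = 2 \<or> length ys = 3" using assms ys by (auto simp: low_def)
  then consider x y where "ys = [x, y]" | x y z where "ys = [x, y, z]"
    by (auto simp: numeral_eq_Suc length_Suc_conv)
  then show False
  proof cases
    case 1
    then have nv: "nbrs v = {a, b, c, x, y}" using ys by auto
    show False
      by (rule refutes_sound[OF refute_degree_5_nonmatching, of "[v, a, b, c, x, y]"])
        (use d nv abc 1 in \<open>simp_all add: edge_iff_nbrs\<close>)
  next
    case 2
    then have nv: "nbrs v = {a, b, c, x, y, z}" using ys by auto
    show False
      by (rule refutes_sound[OF refute_degree_6_nonmatching, of "[v, a, b, c, x, y, z]"])
        (use d nv abc 2 in \<open>simp_all add: edge_iff_nbrs\<close>)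
  qed
qed

lemma matching_linkD:
  assumes "matching_link v" "a \<in> nbrs v" "b \<in> nbrs v" "c \<in> nbrs v" "a \<noteq> b" "a \<noteq> c" "b \<noteq> c"
  shows "b \<in> nbrs a \<or> c \<in> nbrs a"
  using assms unfolding matching_link_def edge_iff_nbrs by auto

text \<open>\<open>w\<close> belongs to the link of \<open>u\<close>, and all these vertices are
  non-neighbours of \<open>w\<close> in that link.\<close>

lemma matching_link_private_le_1:
  assumes "matching_link u" "w \<in> nbrs u"
  shows "card (nbrs u - nbrs w - {w}) \<le> Suc 0"
proof (rule card_le_Suc0_iff_eq[THEN iffD2])
  show "\<forall>x \<in> nbrs u - nbrs w - {w}. \<forall>y \<in> nbrs u - nbrs w - {w}. x = y"
    using matching_linkD[OF assms(1,2)] by blast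
qed simp

text \<open>Follows the index order of the certificates: common neighbours, then those of
  \<open>u\<close> alone, then those of \<open>w\<close> alone.\<close>

definition pair_lists :: "'a \<Rightarrow> 'a \<Rightarrow> 'a list \<Rightarrow> 'a list \<Rightarrow> 'a list \<Rightarrow> bool" where
  "pair_lists u w cs ps qs \<longleftrightarrow> distinct cs \<and> distinct ps \<and> distinct qs \<and>
     set cs = nbrs u \<inter> nbrs w \<and> set ps = nbrs u - nbrs w - {w} \<and> set qs = nbrs w - nbrs u - {u}"

lemma pair_listsD:
  assumes "pair_lists u w cs ps qs" "w \<in> nbrs u"
  shows "distinct (u # w # cs @ ps @ qs)"
    and "nbrs u = insert w (set (cs @ ps))" and "nbrs w = insert u (set (cs @ qs))"
    and "deg u = Suc (length cs + length ps)" and "deg w = Suc (length cs + length qs)"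
    and "length ps = card (nbrs u - nbrs w - {w})"
proof -
  have l: "distinct cs" "distinct ps" "distinct qs" "set cs = nbrs u \<inter> nbrs w"
    "set ps = nbrs u - nbrs w - {w}" "set qs = nbrs w - nbrs u - {u}"
    using assms(1) unfolding pair_lists_def by blast+
  have u: "u \<in> nbrs w" using assms(2) nbrs_sym by blast
  show d: "distinct (u # w # cs @ ps @ qs)"
    using l not_self_nbr[of u] not_self_nbr[of w] assms(2) by (auto simp del: not_self_nbr)
  show nu: "nbrs u = insert w (set (cs @ ps))" using l assms(2) by auto
  show nw: "nbrs w = insert u (set (cs @ qs))" using l u by auto
  have "distinct (w # cs @ ps)" "distinct (u # cs @ qs)" using d by auto
  moreover have "nbrs u = set (w # cs @ ps)" "nbrs w = set (u # cs @ qs)"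
    by (simp_all only: nu nw list.set)
  ultimately have "deg u = length (w # cs @ ps)" "deg w = length (u # cs @ qs)"
    using distinct_card by metis+
  then show "deg u = Suc (length cs + length ps)" "deg w = Suc (length cs + length qs)"
    by (simp_all only: length_Cons length_append)
  show "length ps = card (nbrs u - nbrs w - {w})"
    using distinct_card[OF l(2)] l(5) by simp
qed

text \<open>Prescribed vertices come first in their list, so that a pair of known adjacency lands on
  the indices for which the certificate assumes it.\<close>

lemma pair_lists_exist:
  assumes "distinct cs\<^sub>0" "set cs\<^sub>0 \<subseteq> nbrs u \<inter> nbrs w" "distinct qs\<^sub>0" "set qs\<^sub>0 \<subseteq> nbrs w - nbrs u - {u}"
  shows "\<exists>cs ps qs. pair_lists u w (cs\<^sub>0 @ cs) ps (qs\<^sub>0 @ qs)"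
proof -
  obtain cs where cs: "distinct (cs\<^sub>0 @ cs)" "set (cs\<^sub>0 @ cs) = nbrs u \<inter> nbrs w"
    using extend_distinct_list[OF finite_Int[OF disjI1[OF finite_nbrs]] assms(1,2)] by blast
  obtain qs where qs: "distinct (qs\<^sub>0 @ qs)" "set (qs\<^sub>0 @ qs) = nbrs w - nbrs u - {u}"
    using extend_distinct_list[OF finite_Diff[OF finite_Diff[OF finite_nbrs]] assms(3,4)] by blast
  obtain ps where ps: "distinct ps" "set ps = nbrs u - nbrs w - {w}"
    using finite_distinct_list[of "nbrs u - nbrs w - {w}"] by auto
  show ?thesis unfolding pair_lists_def using cs ps qs by blast
qed

lemma low_not_adjacent:
  assumes "low u" "low w"
  shows "w \<notin> nbrs u"
proof -
  have False if w: "w \<in> nbrs u" and uw: "low u" "low w" "deg u \<le> deg w" for u w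
  proof -
    obtain cs ps qs where "pair_lists u w cs ps qs"
      using pair_lists_exist[of "[]" u w "[]"] by auto
    note l = pair_listsD[OF this w]
    have lq: "length qs = card (nbrs w - nbrs u - {u})"
      using \<open>pair_lists u w cs ps qs\<close> distinct_card[of qs] unfolding pair_lists_def by simp
    have ml: "matching_link u" "matching_link w" using uw low_matching_link by auto
    have "length ps \<le> Suc 0" "length qs \<le> Suc 0"
      using matching_link_private_le_1[OF ml(1) w] matching_link_private_le_1[OF ml(2)] w l(6) lq
      by (simp_all only: nbrs_sym[of w])
    moreover have "deg u = 5 \<and> deg w = 5 \<or> deg u = 5 \<and> deg w = 6 \<or> deg u = 6 \<and> deg w = 6"
      using uw by (auto simp: low_def)
    \<comment> \<open>At most one private neighbour on each side leaves exactly five patterns of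
      lengths.\<close>
    ultimately have "length cs = 4 \<and> length ps = 0 \<and> length qs = 0
      \<or> length cs = 3 \<and> length ps = 1 \<and> length qs = 1 \<or> length cs = 4 \<and> length ps = 0 \<and> length qs = 1
      \<or> length cs = 5 \<and> length ps = 0 \<and> length qs = 0 \<or> length cs = 4 \<and> length ps = 1 \<and> length qs = 1"
      using l(4,5) by presburger
    then consider a b c d where "cs = [a, b, c, d]" "ps = []" "qs = []"
      | a b c p q where "cs = [a, b, c]" "ps = [p]" "qs = [q]"
      | a b c d q where "cs = [a, b, c, d]" "ps = []" "qs = [q]"
      | a b c d e where "cs = [a, b, c, d, e]" "ps = []" "qs = []"
      | a b c d p q where "cs = [a, b, c, d]" "ps = [p]" "qs = [q]"
      by (auto simp: numeral_eq_Suc length_Suc_conv)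
    then show False
    proof cases
      case 1
      show False
        by (rule refutes_sound[OF refute_5_5_twins, of "[u, w, a, b, c, d]"])
          (use l(1-3) 1 ml in \<open>auto simp: edge_iff_nbrs\<close>)
    next
      case 2
      show False
        by (rule refutes_sound[OF refute_5_5, of "[u, w, a, b, c, p, q]"])
          (use l(1-3) 2 ml in \<open>auto simp: edge_iff_nbrs\<close>)
    next
      case 3
      show False
        by (rule refutes_sound[OF refute_5_6, of "[u, w, a, b, c, d, q]"])
          (use l(1-3) 3 ml in \<open>auto simp: edge_iff_nbrs\<close>)
    next
      case 4
      show False
        by (rule refutes_sound[OF refute_6_6_twins, of "[u, w, a, b, c, d, e]"])
          (use l(1-3) 4 ml in \<open>auto simp: edge_iff_nbrs\<close>)
    next
      case 5
      show False
        by (rule refutes_sound[OF refute_6_6, of "[u, w, a, b, c, d, p, q]"])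
          (use l(1-3) 5 ml in \<open>auto simp: edge_iff_nbrs\<close>)
    qed
  qed
  from this[of w u] this[of u w] show ?thesis
    using assms nbrs_sym[of w u] by (cases "deg u \<le> deg w") auto
qed

section \<open>Neighbours of degree 7\<close>

lemma six_seven_structure:
  assumes "deg u = 6" "deg w = 7" "w \<in> nbrs u"
  shows "\<exists>p. nbrs u - nbrs w - {w} = {p}"
    and "\<And>a b. a \<in> nbrs u \<inter> nbrs w \<Longrightarrow> b \<in> nbrs u \<inter> nbrs w \<Longrightarrow> a \<noteq> b \<Longrightarrow> b \<in> nbrs a"
proof -
  have ml: "matching_link u" using assms(1) low_matching_link by (simp add: low_def)
  have le: "card (nbrs u - nbrs w - {w}) \<le> Suc 0"
    by (rule matching_link_private_le_1[OF ml assms(3)])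
  have ne: "card (nbrs u - nbrs w - {w}) \<noteq> 0"
  proof
    assume 0: "card (nbrs u - nbrs w - {w}) = 0"
    obtain cs ps qs where "pair_lists u w cs ps qs"
      using pair_lists_exist[of "[]" u w "[]"] by auto
    note l = pair_listsD[OF this assms(3)]
    have "length cs = 5 \<and> length ps = 0 \<and> length qs = 1"
      using l(4-6) assms(1,2) 0 by simp
    then obtain a b c d e q where x: "cs = [a, b, c, d, e]" "ps = []" "qs = [q]"
      by (auto simp: numeral_eq_Suc length_Suc_conv)
    show False
      by (rule refutes_sound[OF refute_6_7_dominating, of "[u, w, a, b, c, d, e, q]"])
        (use l(1-3) x ml in \<open>auto simp: edge_iff_nbrs\<close>)
  qed
  have one: "card (nbrs u - nbrs w - {w}) = 1" using le ne by linarith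
  then show "\<exists>p. nbrs u - nbrs w - {w} = {p}" by (rule card_1_singletonE) blast
  show "b \<in> nbrs a" if ab: "a \<in> nbrs u \<inter> nbrs w" "b \<in> nbrs u \<inter> nbrs w" "a \<noteq> b" for a b
  proof (rule ccontr)
    assume nonadj: "b \<notin> nbrs a"
    have ab': "distinct [a, b]" "set [a, b] \<subseteq> nbrs u \<inter> nbrs w" using ab by auto
    obtain cs ps qs where "pair_lists u w ([a, b] @ cs) ps qs"
      using pair_lists_exist[of "[a, b]" u w "[]"] ab' by auto
    note l = pair_listsD[OF this assms(3)]
    have "length cs = 2 \<and> length ps = 1 \<and> length qs = 2"
      using l(4-6) assms(1,2) one by simp
    then obtain c d p q q' where x: "cs = [c, d]" "ps = [p]" "qs = [q, q']"
      by (auto simp: numeral_eq_Suc length_Suc_conv)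
    show False
      by (rule refutes_sound[OF refute_6_7_nonclique, of "[u, w, a, b, c, d, p, q, q']"])
        (use l(1-3) x ml nonadj in \<open>auto simp: edge_iff_nbrs\<close>)
  qed
qed

text \<open>Let \<open>p\<close> be the one vertex of the link of \<open>u\<close> that
  \<open>w\<close> misses. A vertex \<open>v\<close> of degree 7 other than \<open>w\<close> and
  \<open>p\<close> also misses some vertex of the link. As the common neighbours of \<open>u\<close>
  and \<open>w\<close> form a clique, that vertex is \<open>p\<close> again, and then
  \<open>p\<close> misses both \<open>v\<close> and \<open>w\<close>.\<close>

lemma six_card_sevens_le:
  assumes "deg u = 6"
  shows "card {w \<in> nbrs u. deg w = 7} \<le> 2"
proof (cases "\<exists>w \<in> nbrs u. deg w = 7")
  case False
  then have "{w \<in> nbrs u. deg w = 7} = {}" by blast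
  then show ?thesis by (simp only: card.empty)
next
  case True
  then obtain w where w: "w \<in> nbrs u" "deg w = 7" by auto
  obtain p where p: "nbrs u - nbrs w - {w} = {p}"
    using six_seven_structure(1)[OF assms w(2,1)] by blast
  note clique = six_seven_structure(2)[OF assms w(2,1)]
  have ml: "matching_link u" using assms low_matching_link by (simp add: low_def)
  have "{w \<in> nbrs u. deg w = 7} \<subseteq> {w, p}"
  proof (rule ccontr)
    assume "\<not> {w \<in> nbrs u. deg w = 7} \<subseteq> {w, p}"
    then obtain v where v: "v \<in> nbrs u" "deg v = 7" "v \<noteq> w" "v \<noteq> p" by auto
    then have vC: "v \<in> nbrs u \<inter> nbrs w" using p by blast
    obtain r where "nbrs u - nbrs v - {v} = {r}"
      using six_seven_structure(1)[OF assms v(2,1)] by blast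
    then have r: "r \<in> nbrs u" "r \<notin> nbrs v" "r \<noteq> v" by blast+
    have "r \<noteq> w" using r vC nbrs_sym by blast
    moreover have "r \<notin> nbrs w" using r clique[OF vC] by blast
    ultimately have "r = p" using p r by blast
    then have "w \<notin> nbrs r" "v \<notin> nbrs r" using p r nbrs_sym by blast+
    then show False using matching_linkD[OF ml r(1) w(1) v(1)] \<open>r \<noteq> w\<close> r v by blast
  qed
  then have "card {w \<in> nbrs u. deg w = 7} \<le> card {w, p}" by (intro card_mono) auto
  also have "\<dots> \<le> 2" using card_insert_le_m1[of 2 "{p}" w] by simp
  finally show ?thesis .
qed

text \<open>Makes the surroundings of \<open>u\<close> and \<open>w\<close> rigid enough for
  certificates around three vertices. The first two facts need one certificate for each possible
  number, zero or one, of vertices in the link of \<open>u\<close> that \<open>w\<close>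
  misses.\<close>

lemma five_seven_structure:
  assumes "deg u = 5" "deg w = 7" "w \<in> nbrs u"
  shows "\<And>a b. a \<in> nbrs u \<inter> nbrs w \<Longrightarrow> b \<in> nbrs u \<inter> nbrs w \<Longrightarrow> a \<noteq> b \<Longrightarrow> b \<in> nbrs a"
    and "\<And>a q. a \<in> nbrs u \<inter> nbrs w \<Longrightarrow> q \<in> nbrs w - nbrs u - {u} \<Longrightarrow> q \<in> nbrs a"
    and "\<And>q q'. nbrs u - nbrs w - {w} = {} \<Longrightarrow> q \<in> nbrs w - nbrs u - {u} \<Longrightarrow>
      q' \<in> nbrs w - nbrs u - {u} \<Longrightarrow> q' \<notin> nbrs q"
proof -
  have ml: "matching_link u" using assms(1) low_matching_link by (simp add: low_def)
  have le: "card (nbrs u - nbrs w - {w}) \<le> Suc 0"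
    by (rule matching_link_private_le_1[OF ml assms(3)])
  show "b \<in> nbrs a" if ab: "a \<in> nbrs u \<inter> nbrs w" "b \<in> nbrs u \<inter> nbrs w" "a \<noteq> b" for a b
  proof (rule ccontr)
    assume nonadj: "b \<notin> nbrs a"
    have ab': "distinct [a, b]" "set [a, b] \<subseteq> nbrs u \<inter> nbrs w" using ab by auto
    obtain cs ps qs where "pair_lists u w ([a, b] @ cs) ps qs"
      using pair_lists_exist[of "[a, b]" u w "[]"] ab' by auto
    note l = pair_listsD[OF this assms(3)]
    have "length ps = 0 \<or> length ps = 1" using l(6) le by linarith
    then have "length cs = 2 \<and> length ps = 0 \<and> length qs = 2 \<or> length cs = 1 \<and> length ps = 1 \<and> length qs = 3"
      using l(4,5) assms(1,2) by auto
    then consider c d q q' where "cs = [c, d]" "ps = []" "qs = [q, q']"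
      | c p q q' q'' where "cs = [c]" "ps = [p]" "qs = [q, q', q'']"
      by (auto simp: numeral_eq_Suc length_Suc_conv)
    then show False
    proof cases
      case 1
      show False
        by (rule refutes_sound[OF refute_5_7_dominating_nonclique, of "[u, w, a, b, c, d, q, q']"])
          (use l(1-3) 1 ml nonadj in \<open>auto simp: edge_iff_nbrs\<close>)
    next
      case 2
      show False
        by (rule refutes_sound[OF refute_5_7_nonclique, of "[u, w, a, b, c, p, q, q', q'']"])
          (use l(1-3) 2 ml nonadj in \<open>auto simp: edge_iff_nbrs\<close>)
    qed
  qed
  show "q \<in> nbrs a" if a: "a \<in> nbrs u \<inter> nbrs w" and q: "q \<in> nbrs w - nbrs u - {u}" for a q
  proof (rule ccontr)
    assume nonadj: "q \<notin> nbrs a"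
    have aq: "distinct [a]" "set [a] \<subseteq> nbrs u \<inter> nbrs w" "distinct [q]"
      "set [q] \<subseteq> nbrs w - nbrs u - {u}" using a q by auto
    obtain cs ps qs where "pair_lists u w ([a] @ cs) ps ([q] @ qs)"
      using pair_lists_exist[of "[a]" u w "[q]"] aq by auto
    note l = pair_listsD[OF this assms(3)]
    have "length ps = 0 \<or> length ps = 1" using l(6) le by linarith
    then have "length cs = 3 \<and> length ps = 0 \<and> length qs = 1 \<or> length cs = 2 \<and> length ps = 1 \<and> length qs = 2"
      using l(4,5) assms(1,2) by auto
    then consider b c d q' where "cs = [b, c, d]" "ps = []" "qs = [q']"
      | b c p q' q'' where "cs = [b, c]" "ps = [p]" "qs = [q', q'']"
      by (auto simp: numeral_eq_Suc length_Suc_conv)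
    then show False
    proof cases
      case 1
      show False
        by (rule refutes_sound[OF refute_5_7_dominating_nonjoin, of "[u, w, a, b, c, d, q, q']"])
          (use l(1-3) 1 ml nonadj in \<open>auto simp: edge_iff_nbrs\<close>)
    next
      case 2
      show False
        by (rule refutes_sound[OF refute_5_7_nonjoin, of "[u, w, a, b, c, p, q, q', q'']"])
          (use l(1-3) 2 ml nonadj in \<open>auto simp: edge_iff_nbrs\<close>)
    qed
  qed
  show "q' \<notin> nbrs q" if P: "nbrs u - nbrs w - {w} = {}" and q: "q \<in> nbrs w - nbrs u - {u}"
      "q' \<in> nbrs w - nbrs u - {u}" for q q'
  proof
    assume adj: "q' \<in> nbrs q"
    then have "q \<noteq> q'" by auto
    then have qq: "distinct [q, q']" "set [q, q'] \<subseteq> nbrs w - nbrs u - {u}" using q by auto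
    obtain cs ps qs where "pair_lists u w cs ps ([q, q'] @ qs)"
      using pair_lists_exist[of "[]" u w "[q, q']"] qq by auto
    note l = pair_listsD[OF this assms(3)]
    have "ps = []" using l(6) P by (simp only: card.empty length_0_conv)
    then have "length cs = 4 \<and> ps = [] \<and> qs = []"
      using l(4,5) assms(1,2) by simp
    then obtain a b c d where x: "cs = [a, b, c, d]" "ps = []" "qs = []"
      by (auto simp: numeral_eq_Suc length_Suc_conv)
    show False
      by (rule refutes_sound[OF refute_5_7_dominating_outer_edge, of "[u, w, a, b, c, d, q, q']"])
        (use l(1-3) x ml adj in \<open>auto simp: edge_iff_nbrs\<close>)
  qed
qed

text \<open>If \<open>w\<close> sees the whole link, clique and join give \<open>v\<close> seven
  known neighbours, which is its full degree. All three neighbourhoods are then known.\<close>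

lemma five_two_sevens_private:
  assumes u: "deg u = 5" and w: "deg w = 7" "w \<in> nbrs u" and v: "deg v = 7" "v \<in> nbrs u" "v \<noteq> w"
  shows "nbrs u - nbrs w - {w} \<noteq> {}"
proof
  assume P: "nbrs u - nbrs w - {w} = {}"
  note str = five_seven_structure[OF u w]
  have ml: "matching_link u" using u low_matching_link by (simp add: low_def)
  have vC: "v \<in> nbrs u \<inter> nbrs w" using P v by blast
  then have "set [v] \<subseteq> nbrs u \<inter> nbrs w" by simp
  then obtain cs ps qs where pl: "pair_lists u w ([v] @ cs) ps qs"
    using pair_lists_exist[of "[v]" u w "[]"] by auto
  note l = pair_listsD[OF pl w(2)]
  have "length ps = 0" using l(6) P by (simp only: card.empty)
  then have "length cs = 3 \<and> length ps = 0 \<and> length qs = 2" using l(4,5) u w by simp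
  then obtain a b c q q' where x: "cs = [a, b, c]" "ps = []" "qs = [q, q']"
    by (auto simp: numeral_eq_Suc length_Suc_conv)
  have C: "nbrs u \<inter> nbrs w = {v, a, b, c}" and Q: "nbrs w - nbrs u - {u} = {q, q'}"
    using pl x unfolding pair_lists_def by auto
  have cl: "{a, b, c} \<subseteq> nbrs v" "{b, c} \<subseteq> nbrs a" "c \<in> nbrs b"
    using str(1) l(1) unfolding C x by auto
  have jn: "{q, q'} \<subseteq> nbrs v" "{q, q'} \<subseteq> nbrs a" "{q, q'} \<subseteq> nbrs b" "{q, q'} \<subseteq> nbrs c"
    using str(2) unfolding C Q by auto
  have "q' \<notin> nbrs q" using str(3)[OF P] unfolding Q by blast
  have sub: "{u, w, a, b, c, q, q'} \<subseteq> nbrs v"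
    using cl jn vC nbrs_sym by auto
  moreover have "card {u, w, a, b, c, q, q'} = 7"
    using l(1) x by simp
  ultimately have nv: "nbrs v = {u, w, a, b, c, q, q'}"
    using v(1) card_subset_eq[OF finite_nbrs] by metis
  show False
    by (rule refutes_sound[OF refute_5_7_7_dominating, of "[u, w, v, a, b, c, q, q']"])
      (use l(1-3) x ml nv cl jn \<open>q' \<notin> nbrs q\<close> in \<open>auto simp: edge_iff_nbrs\<close>)
qed

text \<open>As for degree 6: if \<open>v\<close> were a common neighbour, the one vertex missed by
  \<open>w\<close> would be missed by \<open>v\<close> too, against the matching link.\<close>

lemma five_two_sevens_structure:
  assumes u: "deg u = 5" and w: "deg w = 7" "w \<in> nbrs u" and v: "deg v = 7" "v \<in> nbrs u" "v \<noteq> w"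
  shows "nbrs u - nbrs w - {w} = {v}"
proof -
  have ml: "matching_link u" using u low_matching_link by (simp add: low_def)
  have "card (nbrs u - nbrs w - {w}) \<le> Suc 0"
    by (rule matching_link_private_le_1[OF ml w(2)])
  moreover have "card (nbrs u - nbrs w - {w}) \<noteq> 0"
    using five_two_sevens_private[OF assms] by simp
  ultimately have "card (nbrs u - nbrs w - {w}) = 1" by linarith
  then obtain p where p: "nbrs u - nbrs w - {w} = {p}" by (rule card_1_singletonE)
  have "v = p"
  proof (rule ccontr)
    assume "v \<noteq> p"
    then have vC: "v \<in> nbrs u \<inter> nbrs w" using p v by blast
    obtain r where r: "r \<in> nbrs u" "r \<notin> nbrs v" "r \<noteq> v"
      using five_two_sevens_private[OF u v(1,2) w v(3)[symmetric]] by blast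
    have "r \<noteq> w" using r vC nbrs_sym by blast
    moreover have "r \<notin> nbrs w" using r five_seven_structure(1)[OF u w vC] by blast
    ultimately have "r = p" using p r by blast
    then have "w \<notin> nbrs r" "v \<notin> nbrs r" using p r nbrs_sym by blast+
    then show False using matching_linkD[OF ml r(1) w(2) v(2)] \<open>r \<noteq> w\<close> r v by blast
  qed
  then show ?thesis using p by simp
qed

text \<open>\<open>w\<close> and \<open>v\<close> have three outer neighbours each, and the
  certificates allow at most one of them to be shared. So \<open>c\<close> sees \<open>u\<close>,
  the four other neighbours of \<open>u\<close> and at least five outer vertices.\<close>

lemma five_two_sevens_large:
  assumes u: "deg u = 5" and w: "deg w = 7" "w \<in> nbrs u" and v: "deg v = 7" "v \<in> nbrs u" "v \<noteq> w"
    and c: "c \<in> nbrs u" "c \<noteq> w" "c \<noteq> v"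
  shows "deg c \<ge> 10"
proof -
  have ml: "matching_link u" using u low_matching_link by (simp add: low_def)
  have Pw: "nbrs u - nbrs w - {w} = {v}" by (rule five_two_sevens_structure[OF u w v])
  have Pv: "nbrs u - nbrs v - {v} = {w}"
    by (rule five_two_sevens_structure[OF u v(1,2) w v(3)[symmetric]])
  define Q where "Q = nbrs w - nbrs u - {u}"
  define R where "R = nbrs v - nbrs u - {u}"
  have fin: "finite Q" "finite R" by (simp_all add: Q_def R_def)
  have nuw: "u \<in> nbrs w" "u \<in> nbrs v" using w v nbrs_sym by blast+
  define C where "C = nbrs u - {w, v}"
  have C: "nbrs u \<inter> nbrs w = C" "nbrs u \<inter> nbrs v = C"
    using Pw Pv not_self_nbr[of w] not_self_nbr[of v] unfolding C_def by blast+
  have cardC: "card C = 3" unfolding C_def using u w v by (simp add: card_Diff_subset)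
  have nw: "nbrs w = insert u (C \<union> Q)" and nv: "nbrs v = insert u (C \<union> R)"
    using C nuw unfolding Q_def R_def by blast+
  have uC: "u \<notin> C \<union> Q" "u \<notin> C \<union> R" "C \<inter> Q = {}" "C \<inter> R = {}"
    unfolding Q_def R_def C_def by auto
  have "finite C" unfolding C_def by simp
  then have "deg w = Suc (card C + card Q)" "deg v = Suc (card C + card R)"
    unfolding nw nv using uC fin by (simp_all add: card_Un_disjoint)
  then have cQR: "card Q = 3" "card R = 3" using w(1) v(1) cardC by simp_all
  have join: "\<And>a q. a \<in> C \<Longrightarrow> q \<in> Q \<union> R \<Longrightarrow> q \<in> nbrs a"
    using five_seven_structure(2)[OF u w] five_seven_structure(2)[OF u v(1,2)]
    unfolding C Q_def R_def by blast
  have clique: "\<And>a b. a \<in> C \<Longrightarrow> b \<in> C \<Longrightarrow> a \<noteq> b \<Longrightarrow> b \<in> nbrs a"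
    using five_seven_structure(1)[OF u w] unfolding C by blast
  have "card (Q \<inter> R) \<le> 1"
  proof (rule ccontr)
    assume "\<not> card (Q \<inter> R) \<le> 1"
    moreover have "card (Q \<inter> R) \<le> card Q" using fin by (intro card_mono) auto
    ultimately have I: "card (Q \<inter> R) = 2 \<or> card (Q \<inter> R) = 3" using cQR by linarith
    obtain a b c where abc: "C = {a, b, c}" "a \<noteq> b" "a \<noteq> c" "b \<noteq> c"
      using cardC by (auto simp: card_3_iff)
    have cl: "b \<in> nbrs a" "c \<in> nbrs a" "c \<in> nbrs b" using clique abc by auto
    have nu: "nbrs u = {w, v, a, b, c}"
      using abc(1) w v unfolding C_def by auto
    have "v \<notin> nbrs w" using Pw by blast
    have dis: "w \<notin> C \<union> Q \<union> R" "v \<notin> C \<union> Q \<union> R" "u \<notin> C \<union> Q \<union> R" "u \<noteq> w" "u \<noteq> v"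
      using w v not_self_nbr[of u] unfolding C_def Q_def R_def by (auto simp del: not_self_nbr)
    from I show False
    proof
      assume "card (Q \<inter> R) = 2"
      then obtain q q' where qq: "Q \<inter> R = {q, q'}" "q \<noteq> q'" by (auto simp: card_2_iff)
      have "card (Q - Q \<inter> R) = 1" "card (R - Q \<inter> R) = 1"
        using \<open>card (Q \<inter> R) = 2\<close> cQR fin by (simp_all add: card_Diff_subset)
      then obtain y z where yz: "Q - Q \<inter> R = {y}" "R - Q \<inter> R = {z}"
        by (auto simp: card_1_singleton_iff)
      have QR: "Q = {q, q', y}" "R = {q, q', z}" "y \<notin> R" "z \<notin> Q" using qq yz by blast+
      have jn: "{q, q', y, z} \<subseteq> nbrs a" "{q, q', y, z} \<subseteq> nbrs b" "{q, q', y, z} \<subseteq> nbrs c"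
        using join abc(1) QR by auto
      have ds: "distinct [u, w, v, a, b, c, q, q', y, z]"
        using dis abc QR uC qq(2) v(3) by auto
      show False
        by (rule refutes_sound[OF refute_5_7_7_overlap_2, of "[u, w, v, a, b, c, q, q', y, z]"])
          (use ds ml nu nw nv QR(1,2) abc(1) cl jn \<open>v \<notin> nbrs w\<close> in \<open>auto simp: edge_iff_nbrs\<close>)
    next
      assume "card (Q \<inter> R) = 3"
      then have "Q \<inter> R = Q" "Q \<inter> R = R"
        using cQR fin card_subset_eq[of Q "Q \<inter> R"] card_subset_eq[of R "Q \<inter> R"] by auto
      then have "R = Q" by simp
      obtain q q' y where QR: "Q = {q, q', y}" "q \<noteq> q'" "q \<noteq> y" "q' \<noteq> y"
        using cQR by (auto simp: card_3_iff)
      have jn: "{q, q', y} \<subseteq> nbrs a" "{q, q', y} \<subseteq> nbrs b" "{q, q', y} \<subseteq> nbrs c"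
        using join abc(1) QR(1) by auto
      have ds: "distinct [u, w, v, a, b, c, q, q', y]"
        using dis abc QR uC v(3) by auto
      show False
        by (rule refutes_sound[OF refute_5_7_7_overlap_3, of "[u, w, v, a, b, c, q, q', y]"])
          (use ds ml nu nw nv QR(1) \<open>R = Q\<close> abc(1) cl jn \<open>v \<notin> nbrs w\<close> in \<open>auto simp: edge_iff_nbrs\<close>)
    qed
  qed
  then have "card (Q \<union> R) \<ge> 5" using card_Un_Int[OF fin] cQR by linarith
  have cC: "c \<in> C" using c unfolding C_def by blast
  have "insert u (nbrs u - {c}) \<union> (Q \<union> R) \<subseteq> nbrs c"
  proof -
    have "a \<in> nbrs c" if "a \<in> nbrs u - {c}" for a
    proof (cases "a \<in> C")
      case True
      then show ?thesis using clique cC that by blast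
    next
      case False
      then have "a = w \<or> a = v" using that unfolding C_def by blast
      then show ?thesis using cC nw nv nbrs_sym by blast
    qed
    moreover have "u \<in> nbrs c" using c nbrs_sym by blast
    ultimately show ?thesis using join[OF cC] by blast
  qed
  then have "card (insert u (nbrs u - {c}) \<union> (Q \<union> R)) \<le> deg c" by (rule card_mono[OF finite_nbrs])
  moreover have "card (insert u (nbrs u - {c}) \<union> (Q \<union> R)) = card (insert u (nbrs u - {c})) + card (Q \<union> R)"
    using fin uC by (intro card_Un_disjoint) (auto simp: Q_def R_def)
  moreover have "card (insert u (nbrs u - {c})) = 5" using u c(1) by simp
  ultimately show ?thesis using \<open>card (Q \<union> R) \<ge> 5\<close> by linarith
qed

text \<open>Closes the one case of degree 8 in which the charge would not suffice: payments of 6 + 6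
  + 3 or more against a surplus of 12.\<close>

lemma eight_three_low:
  assumes "deg w = 8" "x \<in> nbrs w" "y \<in> nbrs w" "z \<in> nbrs w" "distinct [x, y, z]"
    and "deg x = 5" "deg y = 5" "low z"
  shows False
proof -
  have *: False if x: "x \<in> nbrs w" "deg x = 5" and y: "y \<in> nbrs w" "deg y = 5" and "distinct [x, y, z]"
    and le: "card (nbrs x \<inter> nbrs w) \<le> card (nbrs y \<inter> nbrs w)" for x y
  proof -
    have low: "low x" "low y" "low z" using x y assms by (auto simp: low_def)
    then have ml: "matching_link x" "matching_link y" "matching_link z" using low_matching_link by auto
    have wx: "w \<in> nbrs x" and wy: "w \<in> nbrs y" using x y nbrs_sym by blast+
    have nonadj: "y \<notin> nbrs x" "z \<notin> nbrs x" "z \<notin> nbrs y" "x \<notin> nbrs y" using low low_not_adjacent by auto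
    have split: "card (nbrs v \<inter> nbrs w) + card (nbrs v - nbrs w - {w}) = 4"
      if "deg v = 5" "w \<in> nbrs v" for v
    proof -
      have "nbrs v = insert w ((nbrs v \<inter> nbrs w) \<union> (nbrs v - nbrs w - {w}))" using that by blast
      moreover have "w \<notin> (nbrs v \<inter> nbrs w) \<union> (nbrs v - nbrs w - {w})" by simp
      ultimately have "deg v = Suc (card ((nbrs v \<inter> nbrs w) \<union> (nbrs v - nbrs w - {w})))"
        by (metis card_insert_disjoint finite_Diff finite_Int finite_Un finite_nbrs)
      also have "card ((nbrs v \<inter> nbrs w) \<union> (nbrs v - nbrs w - {w})) =
          card (nbrs v \<inter> nbrs w) + card (nbrs v - nbrs w - {w})"
        by (rule card_Un_disjoint) auto
      finally show ?thesis using that by simp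
    qed
    have px: "card (nbrs x - nbrs w - {w}) \<le> Suc 0"
      by (rule matching_link_private_le_1[OF ml(1) wx])
    define A where "A = nbrs w - {x, y, z}"
    have cardA: "card A = 5" and "finite A"
      unfolding A_def using assms(1,4) x y \<open>distinct [x, y, z]\<close> by (simp_all add: card_Diff_subset)
    define M where "M = nbrs x \<inter> nbrs w"
    define N where "N = nbrs y \<inter> nbrs w"
    have MA: "M \<subseteq> A" "N \<subseteq> A" using nonadj unfolding M_def N_def A_def by auto
    have fMN: "finite M" "finite N" by (simp_all add: M_def N_def)
    obtain cs where cs: "distinct cs" "set cs = M \<inter> N"
      using finite_distinct_list[of "M \<inter> N"] fMN by auto
    obtain ds where ds: "distinct ds" "set ds = M - N"
      using finite_distinct_list[of "M - N"] fMN by auto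
    obtain es where es: "distinct es" "set es = N - M"
      using finite_distinct_list[of "N - M"] fMN by auto
    obtain rs where rs: "distinct rs" "set rs = A - M - N"
      using finite_distinct_list[of "A - M - N"] \<open>finite A\<close> by auto
    obtain ps where ps: "distinct ps" "set ps = nbrs x - nbrs w - {w}"
      using finite_distinct_list[of "nbrs x - nbrs w - {w}"] by auto
    have lM: "length cs + length ds = card M"
    proof -
      have d: "distinct (cs @ ds)" and s: "set (cs @ ds) = M" using cs ds by auto
      from distinct_card[OF d] show ?thesis unfolding s by simp
    qed
    have lN: "length cs + length es = card N"
    proof -
      have d: "distinct (cs @ es)" and s: "set (cs @ es) = N" using cs es by auto
      from distinct_card[OF d] show ?thesis unfolding s by simp
    qed
    have lA: "length cs + length ds + length es + length rs = 5"
    proof -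
      have d: "distinct (cs @ ds @ es @ rs)" and s: "set (cs @ ds @ es @ rs) = A"
        using cs ds es rs MA by auto
      from distinct_card[OF d] show ?thesis unfolding s cardA by simp
    qed
    have lp: "card M + length ps = 4" "length ps \<le> 1"
      using split[OF x(2) wx] distinct_card[OF ps(1)] ps(2) px by (simp_all add: M_def)
    have cN: "card M \<le> card N" "card N \<le> 4"
      using le split[OF y(2) wy] by (simp_all add: M_def N_def)
    have nw: "nbrs w = set (cs @ ds @ es @ rs @ [x, y, z])"
      using cs ds es rs MA x y assms(4) unfolding A_def by auto
    have nx: "nbrs x = insert w (set (cs @ ds @ ps))"
      using cs ds ps wx unfolding M_def by auto
    have ex: "x \<in> nbrs a \<longleftrightarrow> a \<in> set (cs @ ds)" "y \<in> nbrs a \<longleftrightarrow> a \<in> set (cs @ es)" if "a \<in> nbrs w" for a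
      using cs ds es that nbrs_sym[of x a] nbrs_sym[of y a] unfolding M_def N_def by auto
    have dist: "distinct (w # cs @ ds @ es @ rs @ [x, y, z] @ ps)"
    proof -
      have "w \<notin> A" "w \<notin> nbrs x - nbrs w - {w}" "w \<noteq> x" "w \<noteq> y" "w \<noteq> z"
        using x y assms(4) unfolding A_def by auto
      moreover have "{x, y, z} \<inter> A = {}" unfolding A_def by auto
      moreover have "(nbrs x - nbrs w - {w}) \<inter> nbrs w = {}" by auto
      moreover have "A \<subseteq> nbrs w" "{x, y, z} \<subseteq> nbrs w" using x y assms(4) unfolding A_def by auto
      moreover have "set (cs @ ds @ es @ rs) = A" using cs ds es rs MA by auto
      moreover have "distinct (cs @ ds @ es @ rs)" using cs ds es rs by auto
      ultimately show ?thesis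
        using ps \<open>distinct [x, y, z]\<close> by auto
    qed
    \<comment> \<open>\<open>M\<close> and \<open>N\<close> have three or four elements,
      \<open>M\<close> no more than \<open>N\<close>, and their union fits into the five elements of
      \<open>A\<close>. This bounds the intersection from below and leaves seven patterns.\<close>
    have "length cs = 3 \<and> length ds = 0 \<and> length es = 0 \<and> length rs = 2 \<and> length ps = 1
      \<or> length cs = 2 \<and> length ds = 1 \<and> length es = 1 \<and> length rs = 1 \<and> length ps = 1
      \<or> length cs = 1 \<and> length ds = 2 \<and> length es = 2 \<and> length rs = 0 \<and> length ps = 1
      \<or> length cs = 3 \<and> length ds = 0 \<and> length es = 1 \<and> length rs = 1 \<and> length ps = 1
      \<or> length cs = 2 \<and> length ds = 1 \<and> length es = 2 \<and> length rs = 0 \<and> length ps = 1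
      \<or> length cs = 4 \<and> length ds = 0 \<and> length es = 0 \<and> length rs = 1 \<and> length ps = 0
      \<or> length cs = 3 \<and> length ds = 1 \<and> length es = 1 \<and> length rs = 0 \<and> length ps = 0"
      using lM lN lA lp cN by presburger
    then consider a b c d e p where "cs = [a, b, c]" "ds = []" "es = []" "rs = [d, e]" "ps = [p]"
      | a b c d e p where "cs = [a, b]" "ds = [c]" "es = [d]" "rs = [e]" "ps = [p]"
      | a b c d e p where "cs = [a]" "ds = [b, c]" "es = [d, e]" "rs = []" "ps = [p]"
      | a b c d e p where "cs = [a, b, c]" "ds = []" "es = [d]" "rs = [e]" "ps = [p]"
      | a b c d e p where "cs = [a, b]" "ds = [c]" "es = [d, e]" "rs = []" "ps = [p]"
      | a b c d e where "cs = [a, b, c, d]" "ds = []" "es = []" "rs = [e]" "ps = []"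
      | a b c d e where "cs = [a, b, c]" "ds = [d]" "es = [e]" "rs = []" "ps = []"
      by (auto simp: numeral_eq_Suc length_Suc_conv)
    then show False
    proof cases
      case 1
      show False
        by (rule refutes_sound[OF refute_8_three_low_33_3, of "[w, a, b, c, d, e, x, y, z, p]"])
          (use dist nw nx ex 1 ml nonadj in \<open>auto simp: edge_iff_nbrs\<close>)
    next
      case 2
      show False
        by (rule refutes_sound[OF refute_8_three_low_33_2, of "[w, a, b, c, d, e, x, y, z, p]"])
          (use dist nw nx ex 2 ml nonadj in \<open>auto simp: edge_iff_nbrs\<close>)
    next
      case 3
      show False
        by (rule refutes_sound[OF refute_8_three_low_33_1, of "[w, a, b, c, d, e, x, y, z, p]"])
          (use dist nw nx ex 3 ml nonadj in \<open>auto simp: edge_iff_nbrs\<close>)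
    next
      case 4
      show False
        by (rule refutes_sound[OF refute_8_three_low_34_3, of "[w, a, b, c, d, e, x, y, z, p]"])
          (use dist nw nx ex 4 ml nonadj in \<open>auto simp: edge_iff_nbrs\<close>)
    next
      case 5
      show False
        by (rule refutes_sound[OF refute_8_three_low_34_2, of "[w, a, b, c, d, e, x, y, z, p]"])
          (use dist nw nx ex 5 ml nonadj in \<open>auto simp: edge_iff_nbrs\<close>)
    next
      case 6
      show False
        by (rule refutes_sound[OF refute_8_three_low_44_4, of "[w, a, b, c, d, e, x, y, z]"])
          (use dist nw nx ex 6 ml nonadj in \<open>auto simp: edge_iff_nbrs\<close>)
    next
      case 7
      show False
        by (rule refutes_sound[OF refute_8_three_low_44_3, of "[w, a, b, c, d, e, x, y, z]"])
          (use dist nw nx ex 7 ml nonadj in \<open>auto simp: edge_iff_nbrs\<close>)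
    qed
  qed
  \<comment> \<open>\<open>x\<close> and \<open>y\<close> both have degree 5, so they may be
    exchanged to order the two sizes.\<close>
  show False
    using *[of x y] *[of y x] assms by (cases "card (nbrs x \<inter> nbrs w) \<le> card (nbrs y \<inter> nbrs w)") auto
qed

end

section \<open>Low neighbours of a vertex\<close>

text \<open>Induction on the size of the family. If every proper nonempty subfamily has a surplus,
  one index takes any partner and the rest avoids it; otherwise a tight subfamily \<open>J\<close>
  is matched inside its union and the rest outside.\<close>

theorem hall_marriage:
  fixes N :: "'b \<Rightarrow> 'a set"
  assumes "finite B" "\<And>b. b \<in> B \<Longrightarrow> finite (N b)"
    and "\<And>J. J \<subseteq> B \<Longrightarrow> card J \<le> card (\<Union>(N ` J))"
  shows "\<exists>f. inj_on f B \<and> (\<forall>b \<in> B. f b \<in> N b)"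
  using assms
proof (induction "card B" arbitrary: B N rule: less_induct)
  case less
  show ?case
  proof (cases "B = {}")
    case True
    then show ?thesis by simp
  next
    case ne: False
    show ?thesis
    proof (cases "\<exists>J. J \<subset> B \<and> J \<noteq> {} \<and> card (\<Union>(N ` J)) \<le> card J")
      case False
      obtain b where b: "b \<in> B" using ne by auto
      have "card {b} \<le> card (\<Union>(N ` {b}))" using less.prems(3)[of "{b}"] b by simp
      then have "N b \<noteq> {}" by auto
      then obtain x where x: "x \<in> N b" by auto
      have "\<exists>f. inj_on f (B - {b}) \<and> (\<forall>c \<in> B - {b}. f c \<in> N c - {x})"
      proof (rule less.hyps)
        show "card (B - {b}) < card B" using b less.prems(1) by (rule card_Diff1_less[rotated])
        show "finite (B - {b})" using less.prems(1) by simp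
        show "finite (N c - {x})" if "c \<in> B - {b}" for c using that less.prems(2) by simp
        show "card J \<le> card (\<Union>c \<in> J. N c - {x})" if J: "J \<subseteq> B - {b}" for J
        proof (cases "J = {}")
          case False
          have "J \<subset> B" using J b by blast
          then have "card J < card (\<Union>(N ` J))"
            using False \<open>\<nexists>J. J \<subset> B \<and> J \<noteq> {} \<and> card (\<Union>(N ` J)) \<le> card J\<close> not_le by blast
          moreover have "(\<Union>c \<in> J. N c - {x}) = \<Union>(N ` J) - {x}" by blast
          moreover have "card (\<Union>(N ` J)) - 1 \<le> card (\<Union>(N ` J) - {x})"
            by (simp add: card_Diff_singleton_if)
          ultimately show ?thesis by simp
        qed simp
      qed
      then obtain f where f: "inj_on f (B - {b})" "\<And>c. c \<in> B - {b} \<Longrightarrow> f c \<in> N c - {x}" by blast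
      have "inj_on (f(b := x)) B"
        using f by (auto simp: inj_on_def)
      then show ?thesis using f(2) x by (intro exI[of _ "f(b := x)"]) auto
    next
      case True
      then obtain J where J: "J \<subset> B" "J \<noteq> {}" "card (\<Union>(N ` J)) \<le> card J" by blast
      let ?U = "\<Union>(N ` J)"
      have "\<exists>f. inj_on f J \<and> (\<forall>b \<in> J. f b \<in> N b)"
      proof (rule less.hyps)
        show "card J < card B" using J(1) less.prems(1) by (rule psubset_card_mono[rotated])
        show "finite J" using J(1) less.prems(1) finite_subset by blast
      qed (use J(1) less.prems in blast)+
      then obtain f where f: "inj_on f J" "\<And>b. b \<in> J \<Longrightarrow> f b \<in> N b" by blast
      have "\<exists>g. inj_on g (B - J) \<and> (\<forall>b \<in> B - J. g b \<in> N b - ?U)"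
      proof (rule less.hyps)
        show "card (B - J) < card B" using J less.prems(1) by (intro psubset_card_mono) auto
        show "finite (B - J)" using less.prems(1) by simp
        show "finite (N c - ?U)" if "c \<in> B - J" for c using that less.prems(2) by simp
        show "card K \<le> card (\<Union>c \<in> K. N c - ?U)" if K: "K \<subseteq> B - J" for K
        proof -
          have fin: "finite K" "finite J" using K J(1) less.prems(1) finite_subset by blast+
          have "card K + card J = card (K \<union> J)"
            using K fin by (intro card_Un_disjoint[symmetric]) auto
          also have "\<dots> \<le> card (\<Union>(N ` (K \<union> J)))" using K J(1) by (intro less.prems(3)) auto
          also have "\<Union>(N ` (K \<union> J)) = (\<Union>c \<in> K. N c - ?U) \<union> ?U" by blast
          also have "card \<dots> \<le> card (\<Union>c \<in> K. N c - ?U) + card ?U" by (rule card_Un_le)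
          finally show ?thesis using J(3) by linarith
        qed
      qed
      then obtain g where g: "inj_on g (B - J)" "\<And>b. b \<in> B - J \<Longrightarrow> g b \<in> N b - ?U" by blast
      have "inj_on (\<lambda>b. if b \<in> J then f b else g b) B"
      proof (rule inj_onI)
        fix b c assume bc: "b \<in> B" "c \<in> B" "(if b \<in> J then f b else g b) = (if c \<in> J then f c else g c)"
        show "b = c"
          using bc f(1) g(1) f(2)[of b] f(2)[of c] g(2)[of b] g(2)[of c]
          by (auto simp: inj_on_def split: if_splits)
      qed
      then show ?thesis
        using f(2) g(2) by (intro exI[of _ "\<lambda>b. if b \<in> J then f b else g b"]) auto
    qed
  qed
qed

text \<open>Choose a smallest nonempty \<open>J\<close> that sees at most \<open>card J\<close>
  elements. Proper nonempty subfamilies then have a surplus, so putting one index back shows that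
  \<open>J\<close> sees exactly \<open>card J\<close> elements. Hall's condition holds, and the
  matching is onto the union.\<close>

lemma saturating_subfamily:
  fixes N :: "'b \<Rightarrow> 'a set"
  assumes "finite B" "B \<noteq> {}" "\<And>b. b \<in> B \<Longrightarrow> finite (N b) \<and> N b \<noteq> {}"
    and "card (\<Union>(N ` B)) \<le> card B"
  obtains J f where "J \<subseteq> B" "J \<noteq> {}" "inj_on f J" "\<And>b. b \<in> J \<Longrightarrow> f b \<in> N b" "f ` J = \<Union>(N ` J)"
proof -
  let ?P = "\<lambda>J. J \<subseteq> B \<and> J \<noteq> {} \<and> card (\<Union>(N ` J)) \<le> card J"
  obtain J where J: "J \<subseteq> B" "J \<noteq> {}" "card (\<Union>(N ` J)) \<le> card J"
    and min: "\<And>K. ?P K \<Longrightarrow> card J \<le> card K"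
    using ex_has_least_nat[of ?P B card] assms(2,4) by auto
  have finJ: "finite J" using J(1) assms(1) finite_subset by blast
  have finU: "finite (\<Union>(N ` K))" if "K \<subseteq> J" for K
    using that J(1) assms(3) finJ finite_subset by blast
  have strict: "card K < card (\<Union>(N ` K))" if K: "K \<subset> J" "K \<noteq> {}" for K
  proof (rule ccontr)
    assume "\<not> card K < card (\<Union>(N ` K))"
    then have "card J \<le> card K" using K J(1) by (intro min) auto
    then show False using psubset_card_mono[OF finJ K(1)] by simp
  qed
  have ge: "card J \<le> card (\<Union>(N ` J))"
  proof -
    obtain b where b: "b \<in> J" using J(2) by auto
    show ?thesis
    proof (cases "J = {b}")
      case True
      \<comment> \<open>A singleton has no smaller nonempty subfamily; here
        \<open>N b \<noteq> {}\<close> gives the bound.\<close>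
      then show ?thesis using assms(3)[of b] J(1) by (auto simp: Suc_le_eq card_gt_0_iff)
    next
      case False
      then have K: "J - {b} \<subset> J" "J - {b} \<noteq> {}" using b by auto
      have "card J = Suc (card (J - {b}))" by (rule card_Suc_Diff1[OF finJ b, symmetric])
      also have "\<dots> \<le> card (\<Union>(N ` (J - {b})))" using strict[OF K] by simp
      also have "\<dots> \<le> card (\<Union>(N ` J))" using finU[of J] by (intro card_mono) auto
      finally show ?thesis .
    qed
  qed
  have "\<exists>f. inj_on f J \<and> (\<forall>b \<in> J. f b \<in> N b)"
  proof (rule hall_marriage[OF finJ])
    show "finite (N b)" if "b \<in> J" for b using that J(1) assms(3) by blast
    show "card K \<le> card (\<Union>(N ` K))" if "K \<subseteq> J" for K
    proof (cases "K = J \<or> K = {}")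
      case True
      then show ?thesis using ge by auto
    next
      case False
      then show ?thesis using strict[of K] that by (simp add: psubset_eq)
    qed
  qed
  then obtain f where f: "inj_on f J" "\<And>b. b \<in> J \<Longrightarrow> f b \<in> N b" by blast
  have "f ` J = \<Union>(N ` J)"
  proof (rule card_subset_eq)
    show "finite (\<Union>(N ` J))" using finU by simp
    show "f ` J \<subseteq> \<Union>(N ` J)" using f(2) by blast
    show "card (f ` J) = card (\<Union>(N ` J))" using card_image[OF f(1)] ge J(3) by simp
  qed
  then show thesis using that J(1,2) f by blast
qed

context irreducible_graph
begin

lemma triangleI:
  assumes "b \<in> nbrs a" "c \<in> nbrs a" "c \<in> nbrs b"
  shows "{{a, b}, {b, c}, {a, c}} \<in> triangles E"
proof -
  have "a \<noteq> b" "a \<noteq> c" "b \<noteq> c" using assms by auto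
  then show ?thesis using assms unfolding triangles_def mem_Collect_eq edge_iff_nbrs[symmetric]
    by (intro exI[of _ a] exI[of _ b] exI[of _ c]) auto
qed

text \<open>
  A matching between \<open>J\<close> and its whole neighbourhood in the link of \<open>v\<close> gives a reducer: delete
  the matching and all edges from \<open>v\<close> to that neighbourhood.
\<close>

lemma low_nbrs_bound:
  assumes "{u \<in> nbrs v. low u} \<noteq> {}"
  shows "2 * card {u \<in> nbrs v. low u} < deg v"
proof (rule ccontr)
  define B where "B = {u \<in> nbrs v. low u}"
  assume "\<not> 2 * card {u \<in> nbrs v. low u} < deg v"
  then have ge: "deg v \<le> 2 * card B" by (simp add: B_def)
  have B: "B \<subseteq> nbrs v" "finite B" "B \<noteq> {}" using assms by (auto simp: B_def)
  let ?N = "\<lambda>b. nbrs b \<inter> nbrs v"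
  have NB: "?N b \<inter> B = {}" if "b \<in> B" for b
    using that low_not_adjacent[of b] by (auto simp: B_def)
  \<comment> \<open>Low vertices are independent, so what they see in the link of \<open>v\<close>
    lies outside \<open>B\<close>. If \<open>B\<close> is at least half of the neighbourhood, this
    is at most \<open>card B\<close> vertices.\<close>
  have "card (\<Union>(?N ` B)) \<le> card (nbrs v - B)" using NB by (intro card_mono) auto
  also have "\<dots> = deg v - card B" using B by (simp add: card_Diff_subset)
  also have "\<dots> \<le> card B" using ge by simp
  finally have le: "card (\<Union>(?N ` B)) \<le> card B" .
  have "finite (?N b) \<and> ?N b \<noteq> {}" if "b \<in> B" for b
  proof -
    have "{b, v} \<in> E" using that nbrs_sym[of b v] by (simp add: B_def edge_iff_nbrs)
    then show ?thesis by (elim edge_common_nbr) auto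
  qed
  then obtain J f where J: "J \<subseteq> B" "J \<noteq> {}" "inj_on f J" "f ` J = \<Union>(?N ` J)"
    and fN: "\<And>b. b \<in> J \<Longrightarrow> f b \<in> ?N b"
    using saturating_subfamily[OF B(2,3) _ le] by metis
  have finJ: "finite J" using J(1) B(2) finite_subset by blast
  have fB: "f b \<notin> J" if "b \<in> J" for b
    using fN[OF that] NB[of b] J(1) that by blast
  have vJ: "v \<notin> J" "v \<notin> f ` J" using J(1) B(1) fN not_self_nbr[of v] by blast+
  define tri where "tri = (\<lambda>b. {{v, b}, {b, f b}, {v, f b}})"
  define X where "X = (\<lambda>b. {b, f b}) ` J \<union> (\<lambda>b. {v, f b}) ` J"
  have disj: "tri b \<inter> tri c = {}" if "b \<in> J" "c \<in> J" "b \<noteq> c" for b c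
  proof -
    have "f b \<noteq> f c" using J(3) that by (auto simp: inj_on_def)
    moreover have "b \<noteq> f c" "c \<noteq> f b" "b \<noteq> f b" "c \<noteq> f c" using fB[of b] fB[of c] that by metis+
    moreover have "v \<noteq> b" "v \<noteq> c" "v \<noteq> f b" "v \<noteq> f c" using vJ that by auto
    ultimately show ?thesis using that(3) by (auto simp: tri_def doubleton_eq_iff)
  qed
  have ne: "tri b \<noteq> {}" for b by (simp add: tri_def)
  have "inj_on tri J"
    using disj ne by (metis inf.idem inj_onI)
  then have card: "card (tri ` J) = card J" by (rule card_image)
  have "reducer E (tri ` J) X"
    unfolding reducer_def
  proof (intro conjI ballI impI)
    show "tri ` J \<noteq> {}" using J(2) by simp
    show "tri ` J \<subseteq> triangles E"
      using J(1) B(1) fN triangleI unfolding tri_def by blast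
    show "pairwise disjnt (tri ` J)"
      using disj unfolding pairwise_def disjnt_def by blast
    show "finite X" using finJ by (simp add: X_def)
    have "card X \<le> card ((\<lambda>b. {b, f b}) ` J) + card ((\<lambda>b. {v, f b}) ` J)"
      unfolding X_def by (rule card_Un_le)
    also have "\<dots> \<le> card J + card J"
      using finJ by (intro add_mono card_image_le)
    finally show "card X \<le> 2 * card (tri ` J)" using card by simp
  next
    fix T assume T: "T \<in> triangles E" "T \<inter> \<Union>(tri ` J) \<noteq> {}"
    then obtain b where b: "b \<in> J" "{v, b} \<in> T \<or> {b, f b} \<in> T \<or> {v, f b} \<in> T"
      by (auto simp: tri_def)
    show "T \<inter> X \<noteq> {}"
    proof (cases "{v, b} \<in> T")
      case True
      then obtain r where r: "T = {{v, b}, {v, r}, {b, r}}" "{v, r} \<in> E" "{b, r} \<in> E"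
        using T(1) by (elim triangleE)
      \<comment> \<open>Here saturation enters: every common neighbour of \<open>b\<close> and
        \<open>v\<close> is matched, so the edge from \<open>v\<close> to it is deleted.\<close>
      then have "r \<in> f ` J" unfolding J(4) using b(1) by (auto simp: edge_iff_nbrs)
      then have "{v, r} \<in> X" unfolding X_def by blast
      then show ?thesis using r(1) by blast
    next
      case False
      then show ?thesis using b unfolding X_def by blast
    qed
  qed
  then show False using irreducible by blast
qed

end

section \<open>Discharging\<close>

context irreducible_graph
begin

text \<open>
  Charges are scaled by 12: a vertex of degree \<open>d\<close> starts with \<open>12 * (d - 7)\<close>, and low vertices are
  fed by their neighbours of degree at least 8.
\<close>

definition transfer :: "'a \<Rightarrow> 'a \<Rightarrow> nat" where
  "transfer u w = (if low u \<and> w \<in> nbrs u \<and> deg w \<ge> 8 then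
     if deg u = 5 then if deg w \<ge> 10 then 8 else 6 else 3 else 0)"

lemma low_nbr_deg_ge_7:
  assumes "low u" "w \<in> nbrs u"
  shows "deg w \<ge> 7"
proof -
  have "\<not> low w" using assms low_not_adjacent by blast
  moreover have "deg w \<ge> 5" using assms(2) nbrs_sym deg_ge_5 by blast
  ultimately show ?thesis unfolding low_def by linarith
qed

text \<open>In \<open>transfer\<close> the first argument receives and the second pays. Initial
  charges can be negative, so the balance is rearranged into sums of naturals.\<close>

lemma low_receives:
  assumes "low u"
  shows "12 * 7 \<le> 12 * deg u + (\<Sum>w \<in> nbrs u. transfer u w)"
proof (cases "deg u = 5")
  case False
  then have u: "deg u = 6" using assms by (simp add: low_def)
  let ?S = "{w \<in> nbrs u. deg w = 7}"
  have "4 \<le> card (nbrs u - ?S)"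
    using six_card_sevens_le[OF u] u by (simp add: card_Diff_subset)
  then have "12 \<le> (\<Sum>w \<in> nbrs u - ?S. 3 :: nat)" by simp
  also have "\<dots> \<le> (\<Sum>w \<in> nbrs u - ?S. transfer u w)"
  proof (rule sum_mono)
    fix w assume "w \<in> nbrs u - ?S"
    then have "w \<in> nbrs u" "deg w \<ge> 8" using low_nbr_deg_ge_7[OF assms, of w] by auto
    then show "3 \<le> transfer u w" using assms u by (simp add: transfer_def)
  qed
  also have "\<dots> \<le> (\<Sum>w \<in> nbrs u. transfer u w)" by (rule sum_mono2) auto
  finally show ?thesis using u by simp
next
  case u: True
  have ge8: "deg w \<ge> 8" if "w \<in> nbrs u" "deg w \<noteq> 7" for w
    using that low_nbr_deg_ge_7[OF assms that(1)] by linarith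
  let ?S = "{w \<in> nbrs u. deg w = 7}"
  have "24 \<le> (\<Sum>w \<in> nbrs u. transfer u w)"
  proof (cases "card ?S \<le> Suc 0")
    case True
    then have "4 \<le> card (nbrs u - ?S)" using u by (simp add: card_Diff_subset)
    then have "24 \<le> (\<Sum>w \<in> nbrs u - ?S. 6 :: nat)" by simp
    also have "\<dots> \<le> (\<Sum>w \<in> nbrs u - ?S. transfer u w)"
      using ge8 assms u by (intro sum_mono) (simp add: transfer_def)
    also have "\<dots> \<le> (\<Sum>w \<in> nbrs u. transfer u w)" by (rule sum_mono2) auto
    finally show ?thesis .
  next
    case False
    then obtain w v where wv: "w \<in> nbrs u" "deg w = 7" "v \<in> nbrs u" "deg v = 7" "v \<noteq> w"
      by (auto simp: card_le_Suc0_iff_eq)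
    have "card (nbrs u - {w, v}) = 3" using u wv by (simp add: card_Diff_subset)
    then have "24 = (\<Sum>w \<in> nbrs u - {w, v}. 8 :: nat)" by simp
    also have "\<dots> \<le> (\<Sum>w \<in> nbrs u - {w, v}. transfer u w)"
    proof (rule sum_mono)
      fix c assume c: "c \<in> nbrs u - {w, v}"
      then have "deg c \<ge> 10" using five_two_sevens_large[OF u wv(2,1,4,3,5)] by blast
      then show "8 \<le> transfer u c" using c assms u by (simp add: transfer_def)
    qed
    also have "\<dots> \<le> (\<Sum>w \<in> nbrs u. transfer u w)" by (rule sum_mono2) auto
    finally show ?thesis .
  qed
  then show ?thesis using u by simp
qed

lemma high_gives:
  assumes "deg w \<ge> 8"
  shows "12 * 7 + (\<Sum>u \<in> nbrs w. transfer u w) \<le> 12 * deg w"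
proof -
  define B where "B = {u \<in> nbrs w. low u}"
  define F where "F = {u \<in> B. deg u = 5}"
  have "finite B" by (simp add: B_def)
  have FB: "F \<subseteq> B" "card F \<le> card B" using \<open>finite B\<close> by (auto simp: F_def intro: card_mono)
  have sumB: "(\<Sum>u \<in> nbrs w. transfer u w) = (\<Sum>u \<in> B. transfer u w)"
    by (rule sum.mono_neutral_right) (auto simp: B_def transfer_def)
  show ?thesis
  proof (cases "B = {}")
    case True
    then show ?thesis using sumB assms by simp
  next
    case False
    then have bound: "2 * card B < deg w" using low_nbrs_bound[of w] by (simp add: B_def)
    \<comment> \<open>Below degree 10, each low neighbour costs 3 and those of degree 5 cost 3
      more.\<close>
    have le6: "(\<Sum>u \<in> B. transfer u w) \<le> 3 * card B + 3 * card F" if "deg w < 10"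
    proof -
      have "(\<Sum>u \<in> B. transfer u w) \<le> (\<Sum>u \<in> B. 3 + (if deg u = 5 then 3 else 0))"
        using that by (intro sum_mono) (simp add: transfer_def)
      also have "\<dots> = 3 * card B + (\<Sum>u \<in> B. if deg u = 5 then 3 else 0)"
        by (simp add: sum.distrib)
      also have "(\<Sum>u \<in> B. if deg u = 5 then 3 else 0) = (\<Sum>u \<in> F. 3 :: nat)"
        unfolding F_def using \<open>finite B\<close> by (rule sum.inter_filter[symmetric])
      finally show ?thesis by simp
    qed
    consider "deg w = 8" | "deg w = 9" | "deg w \<ge> 10" using assms by linarith
    then show ?thesis
    proof cases
      case 1
      then have "card B \<le> 3" using bound by linarith
      \<comment> \<open>The surplus at degree 8 is 12, so three low neighbours are affordable only
        as 6 + 3 + 3 or less.\<close>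
      moreover have "card F \<le> Suc 0" if "card B = 3"
      proof (rule ccontr)
        assume "\<not> card F \<le> Suc 0"
        then obtain x y where xy: "x \<in> F" "y \<in> F" "x \<noteq> y"
          using \<open>finite B\<close> FB(1) finite_subset[of F B] by (auto simp: card_le_Suc0_iff_eq)
        have "B \<noteq> {x, y}" using that xy(3) by auto
        then obtain z where "z \<in> B" "z \<noteq> x" "z \<noteq> y" using xy FB(1) by blast
        then show False
          using eight_three_low[OF 1, of x y z] xy by (auto simp: F_def B_def)
      qed
      ultimately have "3 * card B + 3 * card F \<le> 12"
        using FB(2) by (cases "card B = 3") simp_all
      then show ?thesis using le6 1 sumB by simp
    next
      case 2
      \<comment> \<open>Fewer than 9/2 low neighbours means at most four, each costing at most 6;
        the surplus is 24.\<close>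
      then show ?thesis using le6 sumB bound FB(2) by simp
    next
      case 3
      have "(\<Sum>u \<in> B. transfer u w) \<le> (\<Sum>u \<in> B. 8)"
        by (rule sum_mono) (simp add: transfer_def)
      then show ?thesis using sumB bound 3 by simp
    qed
  qed
qed

section \<open>Handshake and the final count\<close>

lemma deg_eq_incident: "deg v = card {e \<in> E. v \<in> e}"
proof -
  have "{e \<in> E. v \<in> e} = (\<lambda>w. {v, w}) ` nbrs v"
    using graph unfolding simple_graph_def nbrs_def by (fastforce simp: insert_commute)
  moreover have "inj_on (\<lambda>w. {v, w}) (nbrs v)" by (auto simp: inj_on_def doubleton_eq_iff)
  ultimately show ?thesis by (simp add: card_image)
qed

lemma sum_deg: "(\<Sum>v \<in> \<Union>E. deg v) = 2 * card E"
proof -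
  have card2: "card e = 2 \<and> finite e" if "e \<in> E" for e
    using that graph unfolding simple_graph_def by auto
  have fin: "finite (\<Union>E)" using finite_E card2 by auto
  have "(\<Sum>v \<in> \<Union>E. deg v) = (\<Sum>v \<in> \<Union>E. \<Sum>e \<in> E. if v \<in> e then 1 else 0)"
    using finite_E by (simp add: deg_eq_incident sum.If_cases Int_def)
  also have "\<dots> = (\<Sum>e \<in> E. \<Sum>v \<in> \<Union>E. if v \<in> e then 1 else 0)" by (rule sum.swap)
  also have "\<dots> = (\<Sum>e \<in> E. 2)"
  proof (rule sum.cong)
    fix e assume e: "e \<in> E"
    then have "\<Union>E \<inter> {v. v \<in> e} = e" by auto
    then show "(\<Sum>v \<in> \<Union>E. if v \<in> e then 1 else 0) = (2 :: nat)"
      using fin card2[OF e] by (simp add: sum.If_cases)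
  qed simp
  finally show ?thesis by simp
qed

text \<open>The count runs over \<open>\<Union>E\<close> because an isolated vertex would have a
  deficit that nobody pays.\<close>

lemma average_degree_ge_7: "7 * card (\<Union>E) \<le> 2 * card E"
proof -
  let ?W = "\<Union>E"
  have nbrsW: "nbrs v \<subseteq> ?W" for v by (auto simp: nbrs_def)
  have "?W \<subseteq> V" using graph by (auto simp: simple_graph_def)
  then have fin: "finite ?W" using finite_V finite_subset by blast
  have out: "(\<Sum>w \<in> ?W. transfer v w) = (\<Sum>w \<in> nbrs v. transfer v w)" for v
    using fin nbrsW by (intro sum.mono_neutral_right) (auto simp: transfer_def)
  have inn: "(\<Sum>u \<in> ?W. transfer u v) = (\<Sum>u \<in> nbrs v. transfer u v)" for v
    using fin nbrsW nbrs_sym by (intro sum.mono_neutral_right) (auto simp: transfer_def)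
  have local: "12 * 7 + (\<Sum>u \<in> ?W. transfer u v) \<le> 12 * deg v + (\<Sum>w \<in> ?W. transfer v w)"
    if v: "v \<in> ?W" for v
  proof -
    obtain e where e: "e \<in> E" "v \<in> e" using v by auto
    then obtain w where "w \<in> nbrs v"
      using graph unfolding simple_graph_def nbrs_def by (fastforce simp: insert_commute)
    then have "deg v \<ge> 5" by (rule deg_ge_5)
    then consider "low v" | "deg v = 7" | "deg v \<ge> 8" unfolding low_def by linarith
    then show ?thesis
    proof cases
      case 1
      then have "transfer u v = 0" for u by (auto simp: transfer_def low_def)
      then show ?thesis using low_receives[OF 1] out by simp
    next
      case 2
      then have "transfer u v = 0" for u by (auto simp: transfer_def)
      then show ?thesis using 2 by simp
    next
      case 3
      then show ?thesis using high_gives[OF 3] inn by simp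
    qed
  qed
  have "(\<Sum>v \<in> ?W. 12 * 7 + (\<Sum>u \<in> ?W. transfer u v)) \<le>
      (\<Sum>v \<in> ?W. 12 * deg v + (\<Sum>w \<in> ?W. transfer v w))"
    by (rule sum_mono) (rule local)
  \<comment> \<open>The total received equals the total paid, so the transfers cancel.\<close>
  moreover have "(\<Sum>v \<in> ?W. \<Sum>u \<in> ?W. transfer u v) = (\<Sum>v \<in> ?W. \<Sum>w \<in> ?W. transfer v w)"
    by (rule sum.swap)
  ultimately have "(\<Sum>v \<in> ?W. 12 * 7) \<le> (\<Sum>v \<in> ?W. 12 * deg v)"
    by (simp add: sum.distrib)
  then show ?thesis using sum_deg by (simp flip: sum_distrib_left)
qed

end

section \<open>Maximum average degree and the induction on edges\<close>

lemma finite_density_values: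
  assumes "simple_graph V E"
  shows "finite {2 * real (card E') / real (card V') | V' E'.
      V' \<subseteq> V \<and> V' \<noteq> {} \<and> E' \<subseteq> E \<and> (\<forall>e \<in> E'. e \<subseteq> V')}" (is "finite ?A")
proof -
  have "finite V" "E \<subseteq> Pow V" using assms by (auto simp: simple_graph_def)
  then have "finite (Pow V \<times> Pow E)" by (simp add: finite_subset)
  moreover have "?A \<subseteq> (\<lambda>(V', E'). 2 * real (card E') / real (card V')) ` (Pow V \<times> Pow E)" by auto
  ultimately show ?thesis using finite_subset by blast
qed

lemma mad_ge:
  assumes "simple_graph V E" "V' \<subseteq> V" "V' \<noteq> {}" "E' \<subseteq> E" "\<forall>e \<in> E'. e \<subseteq> V'"
  shows "2 * real (card E') / real (card V') \<le> mad V E"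
  unfolding mad_def using assms(2-5) by (intro Max_ge finite_density_values[OF assms(1)]) auto

text \<open>With \<open>V\<close> nonempty the set of densities is nonempty, so that its
  \<open>Max\<close> is a genuine maximum.\<close>

lemma mad_mono:
  assumes "simple_graph V E" "E' \<subseteq> E" "V \<noteq> {}"
  shows "mad V E' \<le> mad V E"
  unfolding mad_def[of V E']
proof (rule Max.boundedI)
  show "finite {2 * real (card F) / real (card W) | W F.
      W \<subseteq> V \<and> W \<noteq> {} \<and> F \<subseteq> E' \<and> (\<forall>e \<in> F. e \<subseteq> W)}"
    using assms by (intro finite_density_values) (auto simp: simple_graph_def)
  show "{2 * real (card F) / real (card W) | W F.
      W \<subseteq> V \<and> W \<noteq> {} \<and> F \<subseteq> E' \<and> (\<forall>e \<in> F. e \<subseteq> W)} \<noteq> {}"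
    using assms(3) by blast
qed (use assms(2) in \<open>auto intro!: mad_ge[OF assms(1)]\<close>)

theorem theorem1p2:
  fixes V :: "'a set" and E :: "'a set set"
  assumes "simple_graph V E"
    and "mad V E < 7"
  shows "tri_cover E \<le> 2 * tri_packing E"
  using assms
proof (induction "card E" arbitrary: E rule: less_induct)
  case less
  have fin: "finite E"
    using less.prems(1) by (auto simp: simple_graph_def intro!: finite_subset[of E "Pow V"])
  have IH: "tri_cover E' \<le> 2 * tri_packing E'" if "E' \<subset> E" for E'
  proof (rule less.hyps)
    show "card E' < card E" by (rule psubset_card_mono[OF fin that])
    show "simple_graph V E'" using less.prems(1) that by (auto simp: simple_graph_def)
    have "V \<noteq> {}" using less.prems(1) that by (auto simp: simple_graph_def)
    from mad_mono[OF less.prems(1) psubset_imp_subset[OF that] this]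
    show "mad V E' < 7" using less.prems(2) by linarith
  qed
  show ?case
  proof (cases "E = {}")
    case True
    have "tri_cover E \<le> card ({} :: 'a set set)"
      using True by (intro tri_cover_le) (auto simp: triangle_free_def triangles_def)
    then show ?thesis by simp
  next
    case ne: False
    \<comment> \<open>The first two cases negate the assumptions of the locale.\<close>
    consider (edge) e where "e \<in> E" "\<And>T. T \<in> triangles E \<Longrightarrow> e \<notin> T"
      | (red) S X where "reducer E S X" | (irr) "irreducible_graph V E"
      using less.prems(1) unfolding irreducible_graph_def by blast
    then show ?thesis
    proof cases
      case edge
      then show ?thesis by (intro tuza_remove_triangleless_edge[OF _ fin] IH) auto
    next
      case red
      obtain T where T: "T \<in> S" "T \<in> triangles E" using red unfolding reducer_def by blast
      then obtain e where "e \<in> T" "e \<in> E"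
        using triangles_nonempty triangles_subsetD by blast
      \<comment> \<open>A reducer contains a triangle of \<open>E\<close>, so the deletion is
        proper.\<close>
      then have "E - \<Union>S - X \<subset> E" using T(1) by blast
      then show ?thesis by (intro tuza_reducer[OF red fin] IH)
    next
      case irr
      then have le: "7 * card (\<Union>E) \<le> 2 * card E" by (rule irreducible_graph.average_degree_ge_7)
      have W: "\<Union>E \<subseteq> V" "\<Union>E \<noteq> {}" using less.prems(1) ne by (auto simp: simple_graph_def)
      then have "finite (\<Union>E)" using less.prems(1) finite_subset by (auto simp: simple_graph_def)
      then have pos: "0 < real (card (\<Union>E))" using W(2) by (simp add: card_gt_0_iff)
      have "\<forall>e \<in> E. e \<subseteq> \<Union>E" by blast
      \<comment> \<open>All edges on the vertices they cover form one of the subgraphs over which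
        \<open>mad\<close> is the maximum.\<close>
      from mad_ge[OF less.prems(1) W order_refl this]
      have "2 * real (card E) / real (card (\<Union>E)) < 7" using less.prems(2) by linarith
      then have "2 * real (card E) < 7 * real (card (\<Union>E))"
        using pos by (simp add: divide_less_eq)
      then show ?thesis using le by linarith
    qed
  qed
qed

end
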